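(* Let $K$ be an algebraically closed field of characteristic $p\ge3$, let $n\ge2$ and $k\ge2$ be integers such that $k$ divides $p-1$ and $(k-1)(n-1)\ge2$, let $\lambda_1,\ldots,\lambda_{n-2}\in K\setminus\{0,1\}$ be pairwise different, set $\lambda_0:=1$, and let $F_{k,n}=C^k_{\lambda_1,\ldots,\lambda_{n-2}}$ with Cartier operator $\mathscr{C}_{k,n}:H^{1,0}(F_{k,n})\to H^{1,0}(F_{k,n})$. For $(r;\alpha_3,\ldots,\alpha_{n+1})\in I_{k,n}$ let $c_s\in K$ be such that $$\prod_{j=3}^{n+1}(-z^k-\lambda_{j-3})^{\alpha_j(p-1)/k}=\sum_{s=0}^{(p-1)(\alpha_3+\cdots+\alpha_{n+1})}c_sz^s$$ (with $c_s=0$ for all integers $s$ outside this range). Then $$\mathscr{C}_{k,n}(\theta_{r;\alpha_3,\ldots,\alpha_{n+1}})=\sum_{l=1}^{\alpha_3+\cdots+\alpha_{n+1}-1}c_{lp-r-1}^{1/p}\,\theta_{l-1;\alpha_3,\ldots,\alpha_{n+1}}.$$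
   Context: $C^k_{\lambda_1,\ldots,\lambda_{n-2}}\subset\mathbb{P}^n_K$ is the non-singular irreducible projective curve with equations $$x_1^k+x_2^k+x_3^k=0,\quad \lambda_1x_1^k+x_2^k+x_4^k=0,\ \ldots,\ \lambda_{n-2}x_1^k+x_2^k+x_{n+1}^k=0$$ (for $n=2$ it is the Fermat curve $x_1^k+x_2^k+x_3^k=0$). On it set $y_j=x_j/x_1$ for $j=2,\ldots,n+1$ and $z=y_2$. For $r\in\mathbb{Z}$ and $\alpha_3,\ldots,\alpha_{n+1}\in\{0,1,\ldots,k-1\}$ put $$\theta_{r;\alpha_3,\ldots,\alpha_{n+1}}=\frac{z^r\,dz}{y_3^{\alpha_3}\cdots y_{n+1}^{\alpha_{n+1}}},\qquad I_{k,n}=\{(r;\alpha_3,\ldots,\alpha_{n+1}):\alpha_j\in\{0,\ldots,k-1\},\ 0\le r\le\alpha_3+\cdots+\alpha_{n+1}-2\}.$$ $H^{1,0}(X)$ denotes the space of holomorphic (everywhere regular) one-forms on $X$; the forms $\theta_{r;\alpha_3,\ldots,\alpha_{n+1}}$ with index in $I_{k,n}$ belong to $H^{1,0}(F_{k,n})$. Cartier operator in characteristic $p>0$: fix $z\in K(X)\setminus K(X)^p$. A holomorphic form can be written $w\,dz$ with $w=u_0^p+u_1^pz+\cdots+u_{p-1}^pz^{p-1}$, $u_i\in K(X)$; then $\mathscr{C}(w\,dz)=u_{p-1}\,dz$. It is a $1/p$-linear operator $H^{1,0}(X)\to H^{1,0}(X)$ independent of the choice of $z$. *)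

theory Defs
  imports "HOL-Computational_Algebra.Computational_Algebra" "HOL-Library.Poly_Mapping"
    "HOL-Library.FuncSet"
begin

section \<open>Projective space and homogeneous polynomials\<close>

text \<open>Polynomials in the variables \<open>x\<^sub>i\<close> (\<open>i :: nat\<close>), as finitely supported functions on exponent
  vectors; the ring structure is the convolution product of \<^theory>\<open>HOL-Library.Poly_Mapping\<close>.\<close>

type_synonym 'a mpoly = "(nat \<Rightarrow>\<^sub>0 nat) \<Rightarrow>\<^sub>0 'a"

definition pvar :: "nat \<Rightarrow> 'a::comm_ring_1 mpoly" where
  "pvar i = Poly_Mapping.single (Poly_Mapping.single i 1) 1"

definition pconst :: "'a \<Rightarrow> 'a::comm_ring_1 mpoly" where
  "pconst c = Poly_Mapping.single 0 c"

definition peval :: "'a::comm_ring_1 mpoly \<Rightarrow> (nat \<Rightarrow> 'a) \<Rightarrow> 'a" where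
  "peval F x = (\<Sum>m\<in>Poly_Mapping.keys F. Poly_Mapping.lookup F m *
                 (\<Prod>i\<in>Poly_Mapping.keys m. x i ^ Poly_Mapping.lookup m i))"

definition forms :: "nat \<Rightarrow> nat \<Rightarrow> 'a::comm_ring_1 mpoly set" where
  "forms n d = {F. \<forall>m\<in>Poly_Mapping.keys F. Poly_Mapping.keys m \<subseteq> {1..n+1} \<and>
                     (\<Sum>i\<in>Poly_Mapping.keys m. Poly_Mapping.lookup m i) = d}"

text \<open>A point of \<open>\<P>\<^sup>n\<close> is the set of all its homogeneous coordinate vectors
  \<open>(x\<^sub>1, \<dots>, x\<^sub>n\<^sub>+\<^sub>1)\<close>, which are extended by \<open>0\<close> to functions on \<^typ>\<open>nat\<close>.\<close>

type_synonym 'a ppoint = "(nat \<Rightarrow> 'a) set"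

definition proj_space :: "nat \<Rightarrow> 'a::field ppoint set" where
  "proj_space n = {{(\<lambda>i. c * x i) | c. c \<noteq> 0} | x. (\<forall>i. i \<notin> {1..n+1} \<longrightarrow> x i = 0) \<and> (\<exists>i. x i \<noteq> 0)}"

definition vanishes_at :: "'a::field mpoly \<Rightarrow> 'a ppoint \<Rightarrow> bool" where
  "vanishes_at F P \<longleftrightarrow> (\<forall>x\<in>P. peval F x = 0)"

definition vanishes_on :: "'a::field mpoly \<Rightarrow> 'a ppoint set \<Rightarrow> bool" where
  "vanishes_on F X \<longleftrightarrow> (\<forall>P\<in>X. vanishes_at F P)"

definition gf_curve :: "nat \<Rightarrow> nat \<Rightarrow> (nat \<Rightarrow> 'a::field) \<Rightarrow> 'a ppoint set" where
  "gf_curve k n lam = {P \<in> proj_space n.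
     vanishes_at (pvar 1 ^ k + pvar 2 ^ k + pvar 3 ^ k) P \<and>
     (\<forall>i\<in>{1..n-2}. vanishes_at (pconst (lam i) * pvar 1 ^ k + pvar 2 ^ k + pvar (i+3) ^ k) P)}"

section \<open>The function field\<close>

definition fractions :: "nat \<Rightarrow> 'a::field ppoint set \<Rightarrow> ('a mpoly \<times> 'a mpoly) set" where
  "fractions n X = {(G, H). \<exists>d. G \<in> forms n d \<and> H \<in> forms n d \<and> \<not> vanishes_on H X}"

text \<open>For an irreducible projective variety \<open>X \<subseteq> \<P>\<^sup>n\<close>, the elements of \<open>K(X)\<close> are the fractions \<open>G/H\<close> of
  forms of equal degree with \<open>H \<notin> I(X)\<close>, subject to \<open>G/H = G'/H'\<close> iff \<open>GH' - G'H \<in> I(X)\<close>, with the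
  usual sum and product. The field depends on the values \<open>n\<close> and \<open>X\<close>, so it is not a type constructed
  here; instead \<open>function_field n X \<phi>\<close> says that the field \<open>'f\<close> is \<open>K(X)\<close>, where \<open>\<phi> G H\<close> is the class
  of \<open>G/H\<close>. This determines \<open>('f, \<phi>)\<close> up to a unique isomorphism.\<close>

definition function_field ::
    "nat \<Rightarrow> 'a::field ppoint set \<Rightarrow> ('a mpoly \<Rightarrow> 'a mpoly \<Rightarrow> 'f::field) \<Rightarrow> bool" where
  "function_field n X \<phi> \<longleftrightarrow>
     (\<forall>(G, H)\<in>fractions n X. \<forall>(G', H')\<in>fractions n X.
        (\<phi> G H = \<phi> G' H' \<longleftrightarrow> vanishes_on (G * H' - G' * H) X) \<and>
        \<phi> (G * H' + G' * H) (H * H') = \<phi> G H + \<phi> G' H' \<and>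
        \<phi> (G * G') (H * H') = \<phi> G H * \<phi> G' H') \<and>
     (\<forall>f. \<exists>(G, H)\<in>fractions n X. f = \<phi> G H)"

definition ff_const :: "('a::field mpoly \<Rightarrow> 'a mpoly \<Rightarrow> 'f) \<Rightarrow> 'a \<Rightarrow> 'f" where
  "ff_const \<phi> c = \<phi> (pconst c) 1"

definition ycoord :: "('a::field mpoly \<Rightarrow> 'a mpoly \<Rightarrow> 'f) \<Rightarrow> nat \<Rightarrow> 'f" where
  "ycoord \<phi> j = \<phi> (pvar j) (pvar 1)"

definition local_ring ::
    "nat \<Rightarrow> 'a::field ppoint set \<Rightarrow> ('a mpoly \<Rightarrow> 'a mpoly \<Rightarrow> 'f) \<Rightarrow> 'a ppoint \<Rightarrow> 'f set" where
  "local_ring n X \<phi> P = {\<phi> G H | G H. (G, H) \<in> fractions n X \<and> \<not> vanishes_at H P}"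

section \<open>Rational and holomorphic one-forms\<close>

text \<open>The Kaehler differentials \<open>\<Omega>\<close> of \<open>K(X)\<close> over \<open>K\<close>: the free \<open>K(X)\<close>-module with basis the symbols
  \<open>dg\<close> (\<open>g \<in> K(X)\<close>), modulo the submodule of relations. The formal sum \<open>\<Sum> f\<^sub>g dg\<close> is the finitely
  supported function \<open>g \<mapsto> f\<^sub>g\<close>, and a one-form is a coset of the submodule of relations.\<close>

type_synonym 'f formal_diff = "'f \<Rightarrow>\<^sub>0 'f"

definition fscale :: "'f::field \<Rightarrow> 'f formal_diff \<Rightarrow> 'f formal_diff" where
  "fscale c \<eta> = Poly_Mapping.map ((*) c) \<eta>"

lemma lookup_fscale: "Poly_Mapping.lookup (fscale c \<eta>) g = c * Poly_Mapping.lookup \<eta> g"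
  by (simp add: fscale_def Poly_Mapping.map.rep_eq when_def)

lemma module_fscale: "module fscale"
  by unfold_locales
    (auto intro!: poly_mapping_eqI simp: lookup_fscale lookup_add algebra_simps)

definition fd :: "'f::field \<Rightarrow> 'f formal_diff" where
  "fd g = Poly_Mapping.single g 1"

definition kaehler_relations ::
    "('a::field mpoly \<Rightarrow> 'a mpoly \<Rightarrow> 'f::field) \<Rightarrow> 'f formal_diff set" where
  "kaehler_relations \<phi> = module.span fscale
     ({fd (f + g) - fd f - fd g | f g. True} \<union>
      {fd (f * g) - fscale f (fd g) - fscale g (fd f) | f g. True} \<union>
      {fd (ff_const \<phi> c) | c. True})"

definition one_form ::
    "('a::field mpoly \<Rightarrow> 'a mpoly \<Rightarrow> 'f::field) \<Rightarrow> 'f formal_diff \<Rightarrow> 'f formal_diff set" where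
  "one_form \<phi> \<eta> = {\<zeta>. \<zeta> - \<eta> \<in> kaehler_relations \<phi>}"

text \<open>A one-form is regular at \<open>P\<close> if it can be written \<open>\<Sum> f\<^sub>g dg\<close> with all \<open>g\<close> and \<open>f\<^sub>g\<close> in the local
  ring at \<open>P\<close>; it is holomorphic if it is regular at every point of \<open>X\<close>.\<close>

definition regular_at ::
    "nat \<Rightarrow> 'a::field ppoint set \<Rightarrow> ('a mpoly \<Rightarrow> 'a mpoly \<Rightarrow> 'f::field) \<Rightarrow>
      'a ppoint \<Rightarrow> 'f formal_diff set \<Rightarrow> bool" where
  "regular_at n X \<phi> P \<omega> \<longleftrightarrow>
     (\<exists>\<zeta>\<in>\<omega>. \<forall>g\<in>Poly_Mapping.keys \<zeta>.
        g \<in> local_ring n X \<phi> P \<and> Poly_Mapping.lookup \<zeta> g \<in> local_ring n X \<phi> P)"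

definition H10 ::
    "nat \<Rightarrow> 'a::field ppoint set \<Rightarrow> ('a mpoly \<Rightarrow> 'a mpoly \<Rightarrow> 'f::field) \<Rightarrow>
      'f formal_diff set set" where
  "H10 n X \<phi> = {\<omega> \<in> range (one_form \<phi>). \<forall>P\<in>X. regular_at n X \<phi> P \<omega>}"

section \<open>The Cartier operator\<close>

text \<open>The operator computed with an element \<open>t\<close> of \<open>K(X)\<close> that is not a \<open>p\<close>-th power, where \<open>p\<close> is the
  characteristic. It is defined on \<^const>\<open>H10\<close> only.\<close>

definition cartier ::
    "nat \<Rightarrow> 'a::field ppoint set \<Rightarrow> ('a mpoly \<Rightarrow> 'a mpoly \<Rightarrow> 'f::field) \<Rightarrow> 'f \<Rightarrow>
      'f formal_diff set \<Rightarrow> 'f formal_diff set" where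
  "cartier n X \<phi> t = (\<lambda>\<omega>\<in>H10 n X \<phi>. THE \<eta>. \<exists>u.
     \<omega> = one_form \<phi> (fscale (\<Sum>i<CHAR('f). u i ^ CHAR('f) * t ^ i) (fd t)) \<and>
     \<eta> = one_form \<phi> (fscale (u (CHAR('f) - 1)) (fd t)))"

text \<open>The \<open>p\<close>-th root, unique in a field of characteristic \<open>p\<close>.\<close>

definition proot :: "nat \<Rightarrow> 'a::field \<Rightarrow> 'a" where
  "proot p c = (THE b. b ^ p = c)"

section \<open>The forms \<open>\<theta>\<close>\<close>

text \<open>An index \<open>(r; \<alpha>\<^sub>3, \<dots>, \<alpha>\<^sub>n\<^sub>+\<^sub>1)\<close> is a pair \<open>(r, \<alpha>)\<close>; only \<open>\<alpha> j\<close> with \<open>3 \<le> j \<le> n+1\<close> matters.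
  \<open>theta_rep\<close> is the formal differential representing \<open>\<theta>\<close>.\<close>

definition index_set :: "nat \<Rightarrow> nat \<Rightarrow> (int \<times> (nat \<Rightarrow> nat)) set" where
  "index_set k n = {(r, \<alpha>). (\<forall>j\<in>{3..n+1}. \<alpha> j \<in> {0..k-1}) \<and>
                       0 \<le> r \<and> r \<le> int (\<Sum>j=3..n+1. \<alpha> j) - 2}"

definition theta_rep ::
    "nat \<Rightarrow> ('a::field mpoly \<Rightarrow> 'a mpoly \<Rightarrow> 'f::field) \<Rightarrow> int \<Rightarrow> (nat \<Rightarrow> nat) \<Rightarrow> 'f formal_diff" where
  "theta_rep n \<phi> r \<alpha> =
     fscale (ycoord \<phi> 2 powi r / (\<Prod>j=3..n+1. ycoord \<phi> j ^ \<alpha> j)) (fd (ycoord \<phi> 2))"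

end

theory Submission
  imports Defs
begin

text \<open>
  Let \<open>F\<close> be the function field, \<open>z = y\<^sub>2\<close> and \<open>Y = \<Prod> y\<^sub>j ^ \<alpha>\<^sub>j\<close>. Since \<open>k\<close> divides \<open>p - 1\<close> and
  \<open>y\<^sub>j ^ k = - z ^ k - \<lambda>\<^sub>j\<^sub>-\<^sub>3\<close>, the power \<open>y\<^sub>j ^ (p - 1)\<close> is a polynomial in \<open>z\<close>, and so is \<open>Y ^ (p - 1)\<close>: it
  is the polynomial with coefficients \<open>c\<^sub>s\<close> of the statement. Hence
  \<open>z ^ r / Y = (1 / Y) ^ p * z ^ r * Y ^ (p - 1) = (1 / Y) ^ p * (\<Sum> c\<^sub>s * z ^ (s + r))\<close>.
  The Cartier operator is \<open>1/p\<close>-linear, sends \<open>z ^ (l * p - 1) dz\<close> to \<open>z ^ (l - 1) dz\<close> and kills all other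
  \<open>z ^ m dz\<close>. What remains is \<open>1 / Y * (\<Sum> c\<^sub>l\<^sub>p\<^sub>-\<^sub>r\<^sub>-\<^sub>1 ^ (1/p) * z ^ (l - 1)) dz\<close>, and the degree of \<open>Y ^ (p - 1)\<close>
  together with the bound on \<open>r\<close> confines \<open>l\<close> to the stated range (lemma \<open>cart_theta\<close>).

  The work lies in showing that the operator, as it is defined with an arbitrary \<open>t\<close> that is not a \<open>p\<close>-th
  power, really is the one just used.

  The same divisibility gives \<open>y\<^sub>j = y\<^sub>j ^ p / y\<^sub>j ^ (p - 1)\<close> with \<open>y\<^sub>j ^ (p - 1)\<close> in \<open>F\<^sup>p(z)\<close>, so the powers
  \<open>1, z, \<dots>, z ^ (p - 1)\<close> span \<open>F\<close> over its subfield \<open>F\<^sup>p\<close> of \<open>p\<close>-th powers (\<open>frob_span_z\<close>). Because \<open>t\<close>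
  exists, \<open>F \<noteq> F\<^sup>p\<close>, so \<open>z\<close> is not a \<open>p\<close>-th power either, and then these powers form a basis
  (\<open>p_independent\<close>). The basis yields the derivation \<open>d/dz\<close> of \<open>F\<close> and the top-coordinate function
  \<open>cart\<close>. Constants are \<open>p\<close>-th powers, so \<open>d/dz\<close> is a derivation over the ground field and identifies
  the Kaehler differentials with \<open>F dz\<close> (\<open>one_form_eq_iff\<close>): every statement about one-forms
  becomes one about their \<open>dz\<close>-coefficients.

  Independence of \<open>t\<close> rests on the identity \<open>cart (t ^ (p - 1) * t') = t'\<close> (\<open>cart_power_deriv\<close>), where
  \<open>t' = dt/dz\<close>; it shows that
  the top coefficient with respect to \<open>t\<close> describes the same operator (\<open>cart_expansion\<close>), and
  a dimension count shows that every element has an expansion in powers of \<open>t\<close> (\<open>spanning_change\<close>).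

  Finally, the operator is defined on holomorphic forms only, so \<open>\<theta>\<close> has to be shown regular at every
  point (\<open>theta_holomorphic\<close>). Where \<open>x\<^sub>1 \<noteq> 0\<close>, at most one of \<open>x\<^sub>3, \<dots>, x\<^sub>n\<^sub>+\<^sub>1\<close> vanishes, and if
  \<open>x\<^sub>j\<close> does then \<open>dz = - (y\<^sub>j / z) ^ (k - 1) dy\<^sub>j\<close> absorbs the pole because \<open>\<alpha>\<^sub>j \<le> k - 1\<close>. Where \<open>x\<^sub>1 = 0\<close> all
  other coordinates are nonzero, and in terms of \<open>1 / z\<close> the condition is exactly
  \<open>r \<le> \<Sum> \<alpha>\<^sub>j - 2\<close>.
\<close>

section \<open>Powers of the characteristic in a field\<close>

locale frobenius =
  fixes p :: nat and ty :: "'f::field itself"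
  assumes char_p: "CHAR('f) = p" and prime_p: "prime p"
begin

lemma p_pos: "0 < p" and p_gt_1: "1 < p"
  using prime_gt_0_nat[OF prime_p] prime_gt_1_nat[OF prime_p] by auto

lemma frob_0: "(0::'f) ^ p = 0"
  using p_pos by simp

lemma frob_add: "(x + y :: 'f) ^ p = x ^ p + y ^ p"
  using freshmans_dream[where x = x and y = y] char_p prime_p by simp

lemma frob_minus: "(- x :: 'f) ^ p = - (x ^ p)"
  using frob_add[of "-x" x] frob_0 by (simp add: eq_neg_iff_add_eq_0)

lemma frob_diff: "(x - y :: 'f) ^ p = x ^ p - y ^ p"
  using frob_add[of x "-y"] by (simp add: frob_minus)

lemma frob_sum: "(\<Sum>i\<in>A. f i :: 'f) ^ p = (\<Sum>i\<in>A. f i ^ p)"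
  using freshmans_dream_sum[where f = f and A = A] char_p prime_p by simp

lemma frob_of_nat: "(of_nat m :: 'f) ^ p = of_nat m"
  using frob_0 by (induction m) (auto simp: frob_add)

lemma frob_inj: "(x::'f) ^ p = y ^ p \<longleftrightarrow> x = y"
  using frob_diff[of x y] p_pos by (metis eq_iff_diff_eq_0 power_eq_0_iff)

lemma of_nat_eq_0_iff: "(of_nat m :: 'f) = 0 \<longleftrightarrow> p dvd m"
  using of_nat_eq_0_iff_char_dvd[where ?'a='f] char_p by simp

lemma of_nat_nonzero: "0 < m \<Longrightarrow> m < p \<Longrightarrow> (of_nat m :: 'f) \<noteq> 0"
  by (auto simp: of_nat_eq_0_iff dest: dvd_imp_le)

abbreviation frob_poly :: "'f poly \<Rightarrow> 'f poly" where
  "frob_poly \<equiv> map_poly (\<lambda>x. x ^ p)"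

lemma coeff_frob_poly: "coeff (frob_poly U) i = coeff U i ^ p"
  using frob_0 by (simp add: coeff_map_poly)

lemma frob_poly_mult: "frob_poly (U * V) = frob_poly U * frob_poly V"
  by (rule poly_eqI) (simp add: coeff_frob_poly coeff_mult frob_sum power_mult_distrib)

lemma frob_poly_add: "frob_poly (U + V) = frob_poly U + frob_poly V"
  by (rule poly_eqI) (simp add: coeff_frob_poly frob_add)

lemma degree_frob_poly: "degree (frob_poly U) = degree U"
  by (rule degree_map_poly) (use p_pos in auto)

text \<open>The binomial \<open>x ^ p - z ^ p\<close> is purely inseparable. Its divisors are therefore known up to a factor,
  which is what makes the degree of \<open>z\<close> over the subfield of \<open>p\<close>-th powers computable.\<close>

lemma linear_power_p: "[:- z, 1 :: 'f:] ^ p = monom 1 p - [:z ^ p:]"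
proof -
  have "([:-z, 1:] + [:z:]) ^ p = [:-z, 1:] ^ p + [:z:] ^ p"
    using freshmans_dream[where x = "[:-z, 1:]" and y = "[:z:]"] char_p prime_p by simp
  moreover have "[:-z, 1:] + [:z:] = monom (1::'f) 1" by (simp add: monom_altdef)
  moreover have "monom (1::'f) 1 ^ p = monom 1 p" by (simp add: monom_power)
  moreover have "[:z:] ^ p = [:z ^ p:]" by (simp add: poly_const_pow)
  ultimately show ?thesis by simp
qed

lemma dvd_linear_power_imp:
  fixes A B :: "'f poly"
  assumes "A * B = [:- z, 1:] ^ m"
  shows "\<exists>c. A = smult c ([:- z, 1:] ^ degree A)"
proof -
  have nz: "A \<noteq> 0" "B \<noteq> 0" using assms by (metis mult_zero_left mult_zero_right one_neq_zero pCons_eq_0_iff power_not_zero)+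
  have "order z A + order z B = m"
    using order_mult[of A B z] nz assms by (simp add: order_power_n_n)
  moreover have "degree A + degree B = m"
    using degree_mult_eq[OF nz] assms by (simp add: degree_linear_power)
  ultimately have "order z A = degree A"
    using order_degree[OF nz(1), of z] order_degree[OF nz(2), of z] by linarith
  then obtain Q where Q: "A = [:- z, 1:] ^ degree A * Q"
    using order_1[of z A] by (metis dvdE)
  have "Q \<noteq> 0" using Q nz by auto
  then have "degree A = degree A + degree Q"
    using Q degree_mult_eq[of "[:- z, 1:] ^ degree A" Q] by (simp add: degree_linear_power)
  then obtain c where "Q = [:c:]" by (metis add_cancel_right_right degree_eq_zeroE)
  with Q show ?thesis by (intro exI[of _ c]) simp
qed

text \<open>An algebraic relation of degree less than \<open>p\<close> for \<open>z\<close> with coefficients in \<open>F\<^sup>p\<close> forces \<open>z \<in> F\<^sup>p\<close>. The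
  relation is written as \<open>frob_poly U\<close>, with \<open>U\<close> over \<open>F\<close> itself, so that division with remainder can
  be done in \<open>F[x]\<close>. A relation of least degree \<open>d\<close> divides \<open>x ^ p - z ^ p = (x - z) ^ p\<close>, hence is a multiple of
  \<open>(x - z) ^ d\<close>, and the coefficient \<open>- d * z\<close> of \<open>x ^ (d - 1)\<close> lies in \<open>F\<^sup>p\<close>; here \<open>d\<close> is invertible.\<close>

lemma frob_poly_root_imp_power:
  assumes root: "poly (frob_poly U) z = 0" and U: "U \<noteq> 0" "degree U < p"
  shows "z \<in> range (\<lambda>f::'f. f ^ p)"
proof -
  define P where "P = (\<lambda>V. V \<noteq> 0 \<and> poly (frob_poly V) z = 0)"
  have PU: "P U" using root U by (simp add: P_def)
  then obtain V where PV: "P V" and min: "\<And>W. P W \<Longrightarrow> degree V \<le> degree W"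
    using ex_has_least_nat[of P U degree] by blast
  define d where "d = degree V"
  have d: "d < p" using min[OF PU] U by (simp add: d_def)
  \<comment> \<open>The Frobenius twist of \<open>M\<close> is \<open>x ^ p - z ^ p\<close>.\<close>
  define M where "M = monom 1 p - [:z:]"
  have hM: "frob_poly M = [:- z, 1:] ^ p"
    unfolding linear_power_p M_def using p_pos
    by (intro poly_eqI) (auto simp: coeff_frob_poly coeff_pCons frob_diff frob_0 split: nat.split)
  have "M mod V = 0"
  proof (rule ccontr)
    assume nz: "M mod V \<noteq> 0"
    have "frob_poly M = frob_poly (M div V) * frob_poly V + frob_poly (M mod V)"
      by (metis div_mult_mod_eq frob_poly_add frob_poly_mult)
    then have "poly (frob_poly (M mod V)) z = poly (frob_poly M) z"
      using PV by (simp add: P_def)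
    then have "P (M mod V)" using nz p_pos by (simp add: P_def hM)
    then have "degree V \<le> degree (M mod V)" by (rule min)
    then show False using degree_mod_less[of V M] PV nz by (auto simp: P_def)
  qed
  then have "frob_poly V * frob_poly (M div V) = [:- z, 1:] ^ p"
    by (metis hM frob_poly_mult dvd_mult_div_cancel mod_eq_0_iff_dvd)
  then obtain a where a: "frob_poly V = smult a ([:- z, 1:] ^ d)"
    using dvd_linear_power_imp degree_frob_poly d_def by metis
  have a_eq: "a = coeff V d ^ p"
    using arg_cong[OF a, of "\<lambda>q. coeff q d"] by (simp add: coeff_frob_poly coeff_linear_power)
  have "coeff V d \<noteq> 0" using PV by (simp add: P_def d_def)
  then have a0: "a \<noteq> 0" using a_eq by simp
  have "d \<noteq> 0" using PV a a0 by (auto simp: P_def)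
  then have "coeff ([:- z, 1:] ^ d) (d - 1) = of_nat d * (- z)"
    by (subst coeff_linear_poly_power) (auto simp: binomial_symmetric[of "d - Suc 0" d])
  then have "coeff V (d - 1) ^ p = a * (of_nat d * (- z))"
    using arg_cong[OF a, of "\<lambda>q. coeff q (d - 1)"] by (simp add: coeff_frob_poly)
  moreover have "(of_nat d :: 'f) \<noteq> 0" using of_nat_nonzero d \<open>d \<noteq> 0\<close> by simp
  ultimately have "z = - (coeff V (d - 1) ^ p) / (a * of_nat d)"
    using a0 by (simp add: field_simps)
  also have "\<dots> = (- coeff V (d - 1) / (coeff V d * of_nat d)) ^ p"
    by (simp add: a_eq power_divide frob_minus power_mult_distrib frob_of_nat)
  finally show ?thesis by blast
qed

lemma p_independent:
  assumes z: "z \<notin> range (\<lambda>f::'f. f ^ p)" and eq: "(\<Sum>i<p. u i ^ p * z ^ i) = 0" and i: "i < p"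
  shows "u i = 0"
proof (rule ccontr)
  assume ui: "u i \<noteq> 0"
  define U where "U = (\<Sum>i<p. monom (u i) i)"
  have cU: "coeff U j = (if j < p then u j else 0)" for j
    by (simp add: U_def coeff_sum)
  have deg: "degree U \<le> p - 1"
    by (rule degree_le) (auto simp: cU)
  have "poly (frob_poly U) z = (\<Sum>j\<le>p-1. coeff (frob_poly U) j * z ^ j)"
    unfolding poly_altdef using deg
    by (intro sum.mono_neutral_left) (auto simp: degree_frob_poly not_le intro!: coeff_eq_0)
  also have "{..p-1} = {..<p}" using p_pos by auto
  finally have "poly (frob_poly U) z = 0" using eq by (simp add: coeff_frob_poly cU)
  moreover have "U \<noteq> 0" using ui i cU[of i] by auto
  moreover have "degree U < p" using deg p_pos by linarith
  ultimately show False using frob_poly_root_imp_power z by blast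
qed

text \<open>The module \<open>F\<^sup>p[z]\<close>; powers \<open>z ^ i\<close> with \<open>i \<ge> p\<close> are redundant because \<open>z ^ p \<in> F\<^sup>p\<close>. The following lemmas show
  that it is a subfield.\<close>

definition frob_span :: "'f \<Rightarrow> 'f set" where
  "frob_span z = {f. \<exists>u. f = (\<Sum>i<p. u i ^ p * z ^ i)}"

lemma frob_spanI: "f = (\<Sum>i<p. u i ^ p * z ^ i) \<Longrightarrow> f \<in> frob_span z"
  unfolding frob_span_def by (rule CollectI) (rule exI)

lemma frob_span_add: "f \<in> frob_span z \<Longrightarrow> g \<in> frob_span z \<Longrightarrow> f + g \<in> frob_span z"
proof -
  assume "f \<in> frob_span z" "g \<in> frob_span z"
  then obtain u v where "f = (\<Sum>i<p. u i ^ p * z ^ i)" "g = (\<Sum>i<p. v i ^ p * z ^ i)"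
    unfolding frob_span_def by blast
  then have "f + g = (\<Sum>i<p. (u i + v i) ^ p * z ^ i)"
    by (simp add: frob_add distrib_right sum.distrib)
  then show ?thesis by (rule frob_spanI)
qed

lemma frob_span_frob_mult: "f \<in> frob_span z \<Longrightarrow> a ^ p * f \<in> frob_span z"
proof -
  assume "f \<in> frob_span z"
  then obtain u where "f = (\<Sum>i<p. u i ^ p * z ^ i)"
    unfolding frob_span_def by blast
  then have "a ^ p * f = (\<Sum>i<p. (a * u i) ^ p * z ^ i)"
    by (simp add: sum_distrib_left power_mult_distrib mult.assoc)
  then show ?thesis by (rule frob_spanI)
qed

lemma frob_span_z_power: "z ^ m \<in> frob_span z"
proof -
  have small: "z ^ s \<in> frob_span z" if "s < p" for s
  proof -
    have "(\<Sum>i<p. (if i = s then 1 else 0) ^ p * z ^ i) = (\<Sum>i<p. if i = s then z ^ i else 0)"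
      using p_pos by (intro sum.cong) auto
    then have "z ^ s = (\<Sum>i<p. (if i = s then 1 else 0) ^ p * z ^ i)" using that by simp
    then show ?thesis by (rule frob_spanI)
  qed
  have "z ^ m = (z ^ (m div p)) ^ p * z ^ (m mod p)"
    by (metis div_mult_mod_eq power_add power_mult)
  then show ?thesis using frob_span_frob_mult[OF small] p_pos by simp
qed

lemma frob_span_frob: "a ^ p \<in> frob_span z"
  using frob_span_frob_mult[OF frob_span_z_power[of z 0]] by simp

lemma frob_span_sum: "(\<And>i. i \<in> A \<Longrightarrow> f i \<in> frob_span z) \<Longrightarrow> (\<Sum>i\<in>A. f i) \<in> frob_span z"
  by (induction A rule: infinite_finite_induct)
    (use frob_span_frob[of 0] in \<open>auto simp: frob_0 frob_span_add\<close>)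

lemma frob_span_mult: "f \<in> frob_span z \<Longrightarrow> g \<in> frob_span z \<Longrightarrow> f * g \<in> frob_span z"
proof -
  assume "f \<in> frob_span z" "g \<in> frob_span z"
  then obtain u v where "f = (\<Sum>i<p. u i ^ p * z ^ i)" "g = (\<Sum>i<p. v i ^ p * z ^ i)"
    unfolding frob_span_def by blast
  then have "f * g = (\<Sum>i<p. \<Sum>j<p. (u i * v j) ^ p * z ^ (i + j))"
    by (simp add: sum_product power_mult_distrib power_add mult_ac)
  then show ?thesis by (simp only:) (intro frob_span_sum frob_span_frob_mult frob_span_z_power)
qed

lemma frob_span_power: "f \<in> frob_span z \<Longrightarrow> f ^ m \<in> frob_span z"
  by (induction m) (use frob_span_frob[of 1] in \<open>auto simp: frob_span_mult\<close>)

text \<open>Inverses cost nothing: \<open>1 / f = (1 / f) ^ p * f ^ (p - 1)\<close>.\<close>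

lemma frob_span_inverse: "f \<in> frob_span z \<Longrightarrow> inverse f \<in> frob_span z"
proof (cases "f = 0")
  case False
  assume f: "f \<in> frob_span z"
  obtain q where q: "p = Suc q" using p_pos gr0_implies_Suc by blast
  have "inverse f = inverse f ^ p * f ^ q" using False q by (simp add: field_simps)
  then show ?thesis using frob_span_frob_mult[OF frob_span_power[OF f]] by metis
qed auto

end

section \<open>The derivation and the top coordinate attached to a p-basis\<close>

locale p_basis = frobenius p "TYPE('f::field)" for p +
  fixes z :: "'f::field"
  assumes z_not_power: "z \<notin> range (\<lambda>f. f ^ p)"
    and spanning: "\<exists>u. f = (\<Sum>i<p. u i ^ p * z ^ i)"
begin

definition coord :: "'f \<Rightarrow> nat \<Rightarrow> 'f" where
  "coord f = (SOME u. f = (\<Sum>i<p. u i ^ p * z ^ i))"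

lemma coord_expand: "f = (\<Sum>i<p. coord f i ^ p * z ^ i)"
  unfolding coord_def by (rule someI_ex[OF spanning])

lemma coord_eqI: "f = (\<Sum>i<p. u i ^ p * z ^ i) \<Longrightarrow> i < p \<Longrightarrow> coord f i = u i"
proof -
  assume f: "f = (\<Sum>i<p. u i ^ p * z ^ i)" and i: "i < p"
  have "(\<Sum>i<p. (coord f i - u i) ^ p * z ^ i) = f - f"
    using coord_expand[of f] f by (simp add: frob_diff left_diff_distrib sum_subtractf)
  then show ?thesis using p_independent[OF z_not_power, of "\<lambda>i. coord f i - u i" i] i by simp
qed

lemma coord_add: "i < p \<Longrightarrow> coord (f + g) i = coord f i + coord g i"
proof (rule coord_eqI)
  show "f + g = (\<Sum>i<p. (coord f i + coord g i) ^ p * z ^ i)"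
    using coord_expand[of f] coord_expand[of g] by (simp add: frob_add distrib_right sum.distrib)
qed

lemma coord_frob_mult: "i < p \<Longrightarrow> coord (a ^ p * f) i = a * coord f i"
proof (rule coord_eqI)
  show "a ^ p * f = (\<Sum>i<p. (a * coord f i) ^ p * z ^ i)"
    using arg_cong[OF coord_expand[of f], of "\<lambda>x. a ^ p * x"]
    by (simp add: power_mult_distrib sum_distrib_left mult.assoc)
qed

lemma coord_z_power: "i < p \<Longrightarrow> m < p \<Longrightarrow> coord (z ^ m) i = (if i = m then 1 else 0)"
proof (rule coord_eqI)
  assume "m < p"
  have "(\<Sum>i<p. (if i = m then 1 else 0) ^ p * z ^ i) = (\<Sum>i<p. if i = m then z ^ i else 0)"
    using p_pos by (intro sum.cong) auto
  then show "z ^ m = (\<Sum>i<p. (if i = m then 1 else 0) ^ p * z ^ i)"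
    using \<open>m < p\<close> by simp
qed

text \<open>The formal derivative \<open>df/dz\<close> with the elements of \<open>F\<^sup>p\<close> as constants.\<close>

definition deriv :: "'f \<Rightarrow> 'f" where
  "deriv f = (\<Sum>i<p. coord f i ^ p * (of_nat i * z ^ (i - 1)))"

text \<open>The Cartier operator in terms of \<open>dz\<close>-coefficients: \<open>w dz\<close> is sent to \<open>cart w dz\<close>.\<close>

definition cart :: "'f \<Rightarrow> 'f" where
  "cart f = coord f (p - 1)"

lemma deriv_add: "deriv (f + g) = deriv f + deriv g"
  by (simp add: deriv_def coord_add frob_add distrib_right sum.distrib)

lemma deriv_frob_mult: "deriv (a ^ p * f) = a ^ p * deriv f"
  by (simp add: deriv_def coord_frob_mult power_mult_distrib sum_distrib_left mult.assoc)

lemma deriv_0: "deriv 0 = 0"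
  using deriv_add[of 0 0] by (metis add_cancel_right_right add_0_right)

lemma deriv_sum: "deriv (\<Sum>i\<in>A. f i) = (\<Sum>i\<in>A. deriv (f i))"
  by (induction A rule: infinite_finite_induct) (auto simp: deriv_0 deriv_add)

lemma deriv_z_power: "deriv (z ^ m) = of_nat m * z ^ (m - 1)"
proof -
  define s where "s = m mod p"
  have s: "s < p" using p_pos by (simp add: s_def)
  have m: "m = p * (m div p) + s" by (simp add: s_def)
  have zm: "z ^ m = (z ^ (m div p)) ^ p * z ^ s"
    by (subst m) (simp add: power_add mult.commute flip: power_mult)
  have "deriv (z ^ s) = (\<Sum>i<p. if i = s then of_nat i * z ^ (i - 1) else 0)"
    unfolding deriv_def using p_pos s by (intro sum.cong) (auto simp: coord_z_power)
  then have ds: "deriv (z ^ s) = of_nat s * z ^ (s - 1)" using s by simp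
  have "(of_nat m :: 'f) = of_nat s"
    using of_nat_eq_0_iff[of p] by (subst m) simp
  moreover have "(z ^ (m div p)) ^ p * z ^ (s - 1) = z ^ (m - 1)" if "s \<noteq> 0"
  proof -
    have "m - 1 = p * (m div p) + (s - 1)" using m that by linarith
    then show ?thesis by (simp add: power_add mult.commute flip: power_mult)
  qed
  ultimately show ?thesis
    unfolding zm deriv_frob_mult ds by (cases "s = 0") (auto simp: algebra_simps)
qed

lemma deriv_mult: "deriv (f * g) = f * deriv g + g * deriv f"
proof -
  define u where "u = coord f"
  define v where "v = coord g"
  have f: "f = (\<Sum>i<p. u i ^ p * z ^ i)" and g: "g = (\<Sum>j<p. v j ^ p * z ^ j)"
    unfolding u_def v_def by (rule coord_expand)+
  have df: "deriv f = (\<Sum>i<p. u i ^ p * (of_nat i * z ^ (i - 1)))"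
    and dg: "deriv g = (\<Sum>j<p. v j ^ p * (of_nat j * z ^ (j - 1)))"
    unfolding deriv_def u_def v_def by (rule refl)+
  have "f * g = (\<Sum>i<p. \<Sum>j<p. (u i * v j) ^ p * z ^ (i + j))"
    by (subst f, subst g) (simp add: sum_product power_mult_distrib power_add mult_ac)
  then have "deriv (f * g) = (\<Sum>i<p. \<Sum>j<p. (u i * v j) ^ p * (of_nat (i + j) * z ^ (i + j - 1)))"
    by (simp add: deriv_sum deriv_frob_mult deriv_z_power)
  also have "\<dots> = (\<Sum>i<p. \<Sum>j<p. u i ^ p * z ^ i * (v j ^ p * (of_nat j * z ^ (j - 1)))
                             + v j ^ p * z ^ j * (u i ^ p * (of_nat i * z ^ (i - 1))))"
  proof (intro sum.cong refl)
    fix i j :: nat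
    have "of_nat (i + j) * z ^ (i + j - 1) = z ^ i * (of_nat j * z ^ (j - 1)) + z ^ j * (of_nat i * z ^ (i - 1))"
      by (cases i; cases j) (auto simp: algebra_simps power_add)
    then show "(u i * v j) ^ p * (of_nat (i + j) * z ^ (i + j - 1)) =
        u i ^ p * z ^ i * (v j ^ p * (of_nat j * z ^ (j - 1)))
        + v j ^ p * z ^ j * (u i ^ p * (of_nat i * z ^ (i - 1)))"
      by (simp only: power_mult_distrib) (simp add: algebra_simps)
  qed
  also have "\<dots> = f * deriv g + g * deriv f"
  proof -
    have "f * deriv g = (\<Sum>i<p. \<Sum>j<p. u i ^ p * z ^ i * (v j ^ p * (of_nat j * z ^ (j - 1))))"
      unfolding dg by (subst f) (rule sum_product)
    moreover have "g * deriv f = (\<Sum>j<p. \<Sum>i<p. v j ^ p * z ^ j * (u i ^ p * (of_nat i * z ^ (i - 1))))"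
      unfolding df by (subst g) (rule sum_product)
    moreover have "\<dots> = (\<Sum>i<p. \<Sum>j<p. v j ^ p * z ^ j * (u i ^ p * (of_nat i * z ^ (i - 1))))"
      by (rule sum.swap)
    ultimately show ?thesis by (simp only: sum.distrib)
  qed
  finally show ?thesis .
qed

lemma deriv_1: "deriv 1 = 0"
  using deriv_z_power[of 0] by simp

lemma deriv_frob: "deriv (a ^ p) = 0"
  using deriv_frob_mult[of a 1] by (simp add: deriv_1)

lemma deriv_z: "deriv z = 1"
  using deriv_z_power[of 1] by simp

lemma deriv_power: "deriv (f ^ m) = of_nat m * f ^ (m - 1) * deriv f"
proof (induction m)
  case 0
  then show ?case by (simp add: deriv_1)
next
  case (Suc m)
  then show ?case by (cases m) (auto simp: deriv_mult algebra_simps deriv_1)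
qed

lemma deriv_minus: "deriv (- f) = - deriv f"
  using deriv_add[of f "- f"] by (simp add: deriv_0 add_eq_0_iff)

text \<open>The kernel of \<open>d/dz\<close> is \<open>F\<^sup>p\<close>; so \<open>dt \<noteq> 0\<close> for every \<open>t\<close> that is not a \<open>p\<close>-th power.\<close>

lemma deriv_eq_0_imp: "deriv f = 0 \<Longrightarrow> f \<in> range (\<lambda>f. f ^ p)"
proof -
  assume d: "deriv f = 0"
  have "deriv f = (\<Sum>i<p. (if Suc i < p then coord f (Suc i) * of_nat (Suc i) else 0) ^ p * z ^ i)"
  proof -
    obtain q where q: "p = Suc q" using p_pos gr0_implies_Suc by blast
    have "deriv f = (\<Sum>i<q. coord f (Suc i) ^ p * (of_nat (Suc i) * z ^ i))"
      unfolding deriv_def by (subst (1) q, subst sum.lessThan_Suc_shift) simp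
    also have "\<dots> = (\<Sum>i<q. (if Suc i < p then coord f (Suc i) * of_nat (Suc i) else 0) ^ p * z ^ i)"
      by (intro sum.cong) (simp_all only: q lessThan_iff Suc_less_eq if_True power_mult_distrib frob_of_nat[unfolded q] mult.assoc)
    also have "\<dots> = (\<Sum>i<Suc q. (if Suc i < p then coord f (Suc i) * of_nat (Suc i) else 0) ^ p * z ^ i)"
      using q p_pos by simp
    finally show ?thesis using q by simp
  qed
  then have "(if Suc i < p then coord f (Suc i) * of_nat (Suc i) else 0) = 0" if "i < p" for i
    using p_independent[OF z_not_power, of "\<lambda>i. if Suc i < p then coord f (Suc i) * of_nat (Suc i) else 0" i] d that
    by simp
  then have 0: "coord f (Suc i) = 0" if "Suc i < p" for i
    using that of_nat_nonzero[of "Suc i"] by (metis Suc_lessD mult_eq_0_iff zero_less_Suc)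
  have "f = (\<Sum>i<p. coord f i ^ p * z ^ i)" by (rule coord_expand)
  also have "\<dots> = (\<Sum>i<p. if i = 0 then coord f 0 ^ p else 0)"
  proof (intro sum.cong refl)
    fix i assume "i \<in> {..<p}"
    then show "coord f i ^ p * z ^ i = (if i = 0 then coord f 0 ^ p else 0)"
      using 0 frob_0 by (cases i) auto
  qed
  also have "\<dots> = coord f 0 ^ p" using p_pos by simp
  finally show ?thesis by blast
qed

lemma cart_add: "cart (f + g) = cart f + cart g"
  using p_pos by (simp add: cart_def coord_add)

lemma cart_frob_mult: "cart (a ^ p * f) = a * cart f"
  using p_pos by (simp add: cart_def coord_frob_mult)

lemma cart_0: "cart 0 = 0"
  using cart_frob_mult[of 0 0] by simp

lemma cart_sum: "cart (\<Sum>i\<in>A. f i) = (\<Sum>i\<in>A. cart (f i))"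
  by (induction A rule: infinite_finite_induct) (auto simp: cart_0 cart_add)

lemma cart_of_nat_mult: "cart (of_nat m * f) = of_nat m * cart f"
  using cart_frob_mult[of "of_nat m" f] by (simp add: frob_of_nat)

lemma cart_z_power_less: "m < p \<Longrightarrow> cart (z ^ m) = (if m = p - 1 then 1 else 0)"
  using p_pos by (auto simp: cart_def coord_z_power)

text \<open>Exact forms have no \<open>z ^ (p - 1)\<close> term, because \<open>z ^ p\<close> is a constant.\<close>

lemma cart_deriv: "cart (deriv f) = 0"
proof -
  have "cart (deriv f) = (\<Sum>i<p. coord f i * (of_nat i * cart (z ^ (i - 1))))"
    by (simp add: deriv_def cart_sum cart_frob_mult cart_of_nat_mult)
  also have "\<dots> = (\<Sum>i<p. 0)"
    by (intro sum.cong refl) (auto simp: cart_z_power_less split: nat_diff_split)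
  finally show ?thesis by simp
qed

text \<open>Modulo exact forms, \<open>f ^ (p - 1) df\<close> is additive in \<open>f\<close>: formally
  \<open>f ^ (p - 1) df = d(f ^ p) / p\<close>, and \<open>((f + g) ^ p - f ^ p - g ^ p) / p\<close> has integer coefficients. The proof
  writes down this polynomial as \<open>S\<close> and differentiates it.\<close>

lemma cart_power_deriv_add:
  "cart ((f + g) ^ (p - 1) * deriv (f + g)) =
     cart (f ^ (p - 1) * deriv f) + cart (g ^ (p - 1) * deriv g)"
proof -
  define N where "N i = (p choose i) div p" for i
  have N: "p * N i = p choose i" if "i \<in> {1..<p}" for i
    using that prime_p by (auto simp: N_def intro!: dvd_mult_div_cancel dvd_choose_prime)
  define S where "S = (\<Sum>i=1..<p. of_nat (N i) * (f ^ i * g ^ (p - i)))"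
  obtain q where q: "p = Suc q" using p_pos gr0_implies_Suc by blast
  have N1: "N (Suc i) * Suc i = q choose i" if "i < q" for i
  proof -
    have "p * (N (Suc i) * Suc i) = Suc i * (p choose Suc i)" using N[of "Suc i"] that q by (simp add: algebra_simps)
    also have "\<dots> = p * (q choose i)" using Suc_times_binomial_eq[of q i] q by simp
    finally show ?thesis using p_pos by simp
  qed
  have N2: "N i * (p - i) = q choose i" if "i \<in> {1..q}" for i
  proof -
    have "p * (N i * (p - i)) = (p - i) * (p choose i)" using N[of i] that q by (simp add: algebra_simps)
    also have "\<dots> = p * (q choose i)" using binomial_absorb_comp[of p i] q by simp
    finally show ?thesis using p_pos by simp
  qed
  have "deriv S = (\<Sum>i=1..<p. of_nat (N i * i) * (f ^ (i - 1) * g ^ (p - i)) * deriv f)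
                + (\<Sum>i=1..<p. of_nat (N i * (p - i)) * (f ^ i * g ^ (p - i - 1)) * deriv g)"
  proof -
    have "deriv (of_nat m * h) = of_nat m * deriv h" for m h
      using deriv_frob_mult[of "of_nat m" h] by (simp add: frob_of_nat)
    then show ?thesis
      unfolding S_def deriv_sum sum.distrib[symmetric]
      by (intro sum.cong refl) (simp add: deriv_mult deriv_power algebra_simps)
  qed
  also have "(\<Sum>i=1..<p. of_nat (N i * i) * (f ^ (i - 1) * g ^ (p - i)) * deriv f)
           = ((f + g) ^ q - f ^ q) * deriv f"
  proof -
    have "(\<Sum>i=1..<p. of_nat (N i * i) * (f ^ (i - 1) * g ^ (p - i)) * deriv f)
        = (\<Sum>i<q. of_nat (N (Suc i) * Suc i) * (f ^ i * g ^ (q - i)) * deriv f)"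
      by (rule sum.reindex_bij_witness[of _ Suc "\<lambda>i. i - 1"]) (use q in \<open>auto simp del: of_nat_mult\<close>)
    also have "\<dots> = (\<Sum>i<q. of_nat (q choose i) * (f ^ i * g ^ (q - i)) * deriv f)"
      by (intro sum.cong refl) (use N1 in auto)
    also have "\<dots> = ((f + g) ^ q - f ^ q) * deriv f"
      unfolding binomial_ring lessThan_Suc_atMost[symmetric]
      by (simp add: sum_distrib_right sum_distrib_left mult.assoc)
    finally show ?thesis .
  qed
  also have "(\<Sum>i=1..<p. of_nat (N i * (p - i)) * (f ^ i * g ^ (p - i - 1)) * deriv g)
           = ((f + g) ^ q - g ^ q) * deriv g"
  proof -
    have "(\<Sum>i=1..<p. of_nat (N i * (p - i)) * (f ^ i * g ^ (p - i - 1)) * deriv g)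
        = (\<Sum>i=1..q. of_nat (q choose i) * (f ^ i * g ^ (q - i)) * deriv g)"
      by (rule sum.cong) (use N2 q in auto)
    also have "\<dots> = ((f + g) ^ q - g ^ q) * deriv g"
      unfolding binomial_ring atLeast0AtMost[symmetric]
      by (simp add: sum.atLeast_Suc_atMost sum_distrib_right mult.assoc)
    finally show ?thesis .
  qed
  finally have "(f + g) ^ q * deriv (f + g) = (f ^ q * deriv f + g ^ q * deriv g) + deriv S"
    by (simp add: deriv_add algebra_simps)
  then have "cart ((f + g) ^ q * deriv (f + g)) = cart (f ^ q * deriv f) + cart (g ^ q * deriv g)"
    by (simp only: cart_add cart_deriv add_0_right)
  moreover have "p - 1 = q" using q by simp
  ultimately show ?thesis by simp
qed

text \<open>By the previous lemma the defect \<open>cart (f ^ (p - 1) * f') - f'\<close> is additive in \<open>f\<close>, and it satisfies the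
  product rule. So it is a derivation that kills \<open>F\<^sup>p\<close> and \<open>z\<close>, and these generate \<open>F\<close>.\<close>

lemma cart_power_deriv: "cart (f ^ (p - 1) * deriv f) = deriv f"
proof -
  define e where "e f = cart (f ^ (p - 1) * deriv f) - deriv f" for f
  obtain q where q: "p = Suc q" using p_pos gr0_implies_Suc by blast
  have e_add: "e (f + g) = e f + e g" for f g
    unfolding e_def cart_power_deriv_add by (simp add: deriv_add)
  have e_mult: "e (f * g) = f * e g + g * e f" for f g
  proof -
    have "(f * g) ^ q * deriv (f * g) = f ^ p * (g ^ q * deriv g) + g ^ p * (f ^ q * deriv f)"
    proof -
      have "x ^ p = x * x ^ q" for x :: 'f using q by simp
      then show ?thesis by (simp add: deriv_mult algebra_simps power_mult_distrib)
    qed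
    then have eq: "cart ((f * g) ^ q * deriv (f * g)) = f * cart (g ^ q * deriv g) + g * cart (f ^ q * deriv f)"
      by (simp only: cart_add cart_frob_mult)
    have pq: "p - 1 = q" using q by simp
    show ?thesis unfolding e_def pq eq by (simp add: deriv_mult algebra_simps)
  qed
  have e_frob: "e (a ^ p) = 0" for a by (simp add: e_def deriv_frob cart_0)
  have e_z: "e z = 0" using p_pos by (simp add: e_def deriv_z cart_z_power_less)
  have e_zm: "e (z ^ m) = 0" for m
    by (induction m) (use e_frob[of 1] in \<open>auto simp: e_mult e_z\<close>)
  have e_0: "e 0 = 0" using e_frob[of 0] by (simp add: frob_0)
  have e_sum: "e (\<Sum>i\<in>A. h i) = (\<Sum>i\<in>A. e (h i))" for A :: "nat set" and h
    by (induction A rule: infinite_finite_induct) (auto simp: e_add e_0)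
  have "e f = 0"
    by (subst coord_expand[of f]) (simp add: e_sum e_mult e_frob e_zm)
  then show ?thesis by (simp add: e_def)
qed

lemma cart_z_power: "cart (z ^ m) = (if p dvd Suc m then z ^ (Suc m div p - 1) else 0)"
proof -
  define s where "s = m mod p"
  have s: "s < p" using p_pos by (simp add: s_def)
  have m: "m = p * (m div p) + s" by (simp add: s_def)
  have "z ^ m = (z ^ (m div p)) ^ p * z ^ s"
    by (subst m) (simp add: power_add mult.commute flip: power_mult)
  then have "cart (z ^ m) = z ^ (m div p) * (if s = p - 1 then 1 else 0)"
    by (simp add: cart_frob_mult cart_z_power_less s)
  moreover have "p dvd Suc m \<longleftrightarrow> s = p - 1"
    using mod_Suc[of m p] p_pos by (auto simp: s_def dvd_eq_mod_eq_0)
  moreover have "Suc m div p - 1 = m div p" if "p dvd Suc m"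
    using that div_Suc[of m p] by (simp add: dvd_eq_mod_eq_0)
  ultimately show ?thesis by simp
qed

text \<open>For \<open>m + 1\<close> prime to \<open>p\<close>, \<open>t ^ m dt\<close> is the exact form \<open>d(t ^ (m + 1)) / (m + 1)\<close>; the bound on \<open>m\<close> leaves
  \<open>m = p - 1\<close> as the only other case.\<close>

lemma cart_power_mult_deriv:
  assumes "m < 2 * p - 1"
  shows "cart (t ^ m * deriv t) = (if m = p - 1 then deriv t else 0)"
proof (cases "m = p - 1")
  case True
  then show ?thesis using cart_power_deriv[of t] by simp
next
  case False
  have "\<not> p dvd Suc m"
  proof
    assume "p dvd Suc m"
    then obtain c where c: "Suc m = p * c" by blast
    have "c \<noteq> 0" using c by (intro notI) simp
    moreover have "c \<noteq> 1" using c False by (intro notI) simp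
    ultimately have "2 \<le> c" by simp
    then have "2 * p \<le> p * c" by (simp add: mult.commute)
    then show False using c assms by linarith
  qed
  then have nz: "(of_nat (Suc m) :: 'f) \<noteq> 0" using of_nat_eq_0_iff by blast
  have "of_nat (Suc m) * cart (t ^ m * deriv t) = cart (deriv (t ^ Suc m))"
    by (simp only: deriv_power cart_of_nat_mult mult.assoc diff_Suc_1)
  then have "of_nat (Suc m) * cart (t ^ m * deriv t) = 0" by (simp only: cart_deriv)
  then show ?thesis using nz False by simp
qed

text \<open>The Cartier operator computed with \<open>t\<close> agrees with the one computed with \<open>z\<close>: the left-hand side
  is the \<open>z\<close>-version applied to \<open>(\<Sum> u\<^sub>i ^ p * t ^ i) dt\<close>, the right-hand side is the \<open>dz\<close>-coefficient of \<open>u\<^sub>p\<^sub>-\<^sub>1 dt\<close>.\<close>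

lemma cart_expansion:
  "cart ((\<Sum>i<p. u i ^ p * t ^ i) * deriv t) = u (p - 1) * deriv t"
proof -
  have "cart ((\<Sum>i<p. u i ^ p * t ^ i) * deriv t) = (\<Sum>i<p. u i * cart (t ^ i * deriv t))"
    by (simp add: sum_distrib_right cart_sum cart_frob_mult mult.assoc)
  also have "\<dots> = (\<Sum>i<p. if i = p - 1 then u i * deriv t else 0)"
    by (intro sum.cong refl) (auto simp: cart_power_mult_deriv)
  also have "\<dots> = u (p - 1) * deriv t" using p_pos by simp
  finally show ?thesis .
qed

text \<open>With scalars acting through their \<open>p\<close>-th powers, \<open>F\<close> is a vector space over itself of dimension \<open>p\<close>, and
  the \<open>p\<close> powers of \<open>t\<close> are independent by the same lemma as those of \<open>z\<close>.\<close>

lemma spanning_change: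
  assumes t: "t \<notin> range (\<lambda>f::'f. f ^ p)"
  shows "\<exists>u. f = (\<Sum>i<p. u i ^ p * t ^ i)"
proof -
  interpret V: vector_space "\<lambda>a f :: 'f. a ^ p * f"
    by unfold_locales (auto simp: frob_add algebra_simps power_mult_distrib)
  define B where "B x = (\<lambda>i. x ^ i) ` {..<p}" for x :: 'f
  have inj: "inj_on (\<lambda>i. t ^ i) {..<p}"
  proof (rule inj_onI, rule ccontr)
    fix i j assume ij: "i \<in> {..<p}" "j \<in> {..<p}" "t ^ i = t ^ j" "i \<noteq> j"
    \<comment> \<open>A coincidence of two powers would be a linear relation between them.\<close>
    define u where "u = (\<lambda>l. if l = i then 1 else if l = j then - 1 else 0 :: 'f)"
    have "(\<Sum>l<p. u l ^ p * t ^ l) = (\<Sum>l\<in>{i, j}. u l ^ p * t ^ l)"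
      using ij p_pos by (intro sum.mono_neutral_right) (auto simp: u_def)
    also have "\<dots> = 0" using ij by (simp add: u_def frob_minus)
    finally have "u i = 0" using p_independent[OF t] ij by blast
    then show False by (simp add: u_def)
  qed
  have indep: "V.independent (B t)"
  proof (rule V.independent_if_scalars_zero)
    fix h x assume "(\<Sum>x\<in>B t. h x ^ p * x) = 0" "x \<in> B t"
    then show "h x = 0"
      using p_independent[OF t, of "\<lambda>i. h (t ^ i)"] inj by (auto simp: B_def sum.reindex)
  qed (simp add: B_def)
  have sp: "g \<in> V.span (B z)" for g
    by (subst coord_expand[of g], intro V.span_sum V.span_scale V.span_base)
      (auto simp: B_def)
  have "f \<in> V.span (B t)"
  proof (rule ccontr)
    assume f: "f \<notin> V.span (B t)"
    then have "card (insert f (B t)) \<le> card (B z)"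
      using V.independent_span_bound[of "B z" "insert f (B t)"] V.independent_insertI[OF f indep] sp
      by (auto simp: B_def)
    moreover have "card (B z) \<le> p"
      unfolding B_def using card_image_le[of "{..<p}"] by simp
    moreover have "card (B t) = p" unfolding B_def using card_image[OF inj] by simp
    moreover have "f \<notin> B t" using f V.span_base by blast
    moreover have "finite (B t)" by (simp add: B_def)
    ultimately show False by simp
  qed
  then obtain h :: "'f \<Rightarrow> 'f" where "f = (\<Sum>v\<in>B t. h v ^ p * v)"
    using V.span_finite[of "B t"] by (auto simp: B_def)
  then have "f = (\<Sum>i<p. h (t ^ i) ^ p * t ^ i)" using inj by (simp add: B_def sum.reindex)
  then show ?thesis by (rule exI[of _ "\<lambda>i. h (t ^ i)"])
qed

end

section \<open>Kaehler differentials and their dz-coefficients\<close>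

interpretation fdiff: module "fscale :: 'f::field \<Rightarrow> 'f formal_diff \<Rightarrow> 'f formal_diff"
  by (rule module_fscale)

locale p_basis_field = p_basis p z for p and z :: "'f::field" +
  fixes \<phi> :: "'a::field mpoly \<Rightarrow> 'a mpoly \<Rightarrow> 'f"
  assumes const_power: "ff_const \<phi> c \<in> range (\<lambda>f. f ^ p)"
begin

text \<open>The coefficient of \<open>dz\<close>, computed by the rule \<open>dg = g' dz\<close>. It is shown below to vanish exactly on the
  relations, so that it classifies one-forms.\<close>

definition z_coeff :: "'f formal_diff \<Rightarrow> 'f" where
  "z_coeff \<zeta> = (\<Sum>g\<in>Poly_Mapping.keys \<zeta>. Poly_Mapping.lookup \<zeta> g * deriv g)"

lemma z_coeff_superset:
  assumes "finite A" "Poly_Mapping.keys \<zeta> \<subseteq> A"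
  shows "z_coeff \<zeta> = (\<Sum>g\<in>A. Poly_Mapping.lookup \<zeta> g * deriv g)"
  unfolding z_coeff_def using assms by (intro sum.mono_neutral_left) (auto simp: in_keys_iff)

lemma z_coeff_add: "z_coeff (\<eta> + \<zeta>) = z_coeff \<eta> + z_coeff \<zeta>"
proof -
  let ?A = "Poly_Mapping.keys \<eta> \<union> Poly_Mapping.keys \<zeta>"
  have "finite ?A" "Poly_Mapping.keys (\<eta> + \<zeta>) \<subseteq> ?A" by (simp_all add: keys_add)
  then show ?thesis
    by (simp add: z_coeff_superset[of ?A] lookup_add distrib_right sum.distrib)
qed

lemma z_coeff_fscale: "z_coeff (fscale a \<zeta>) = a * z_coeff \<zeta>"
  by (subst z_coeff_superset[of "Poly_Mapping.keys \<zeta>"])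
    (auto simp: in_keys_iff lookup_fscale z_coeff_def sum_distrib_left mult.assoc)

lemma z_coeff_0: "z_coeff 0 = 0"
  by (simp add: z_coeff_def)

lemma z_coeff_diff: "z_coeff (\<eta> - \<zeta>) = z_coeff \<eta> - z_coeff \<zeta>"
  using z_coeff_add[of "\<eta> - \<zeta>" \<zeta>] by simp

lemma z_coeff_sum: "z_coeff (\<Sum>i\<in>A. f i) = (\<Sum>i\<in>A. z_coeff (f i))"
  by (induction A rule: infinite_finite_induct) (auto simp: z_coeff_0 z_coeff_add)

lemma z_coeff_fd: "z_coeff (fd g) = deriv g"
  by (simp add: z_coeff_def fd_def)

lemma z_coeff_relations:
  assumes "\<zeta> \<in> kaehler_relations \<phi>"
  shows "z_coeff \<zeta> = 0"
  using assms unfolding kaehler_relations_def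
proof (rule fdiff.span_induct)
  show "fdiff.subspace {\<zeta>. z_coeff \<zeta> = 0}"
    by (auto simp: fdiff.subspace_def z_coeff_0 z_coeff_add z_coeff_fscale)
next
  fix \<zeta> :: "'f formal_diff"
  assume "\<zeta> \<in> {fd (f + g) - fd f - fd g | f g. True} \<union>
      {fd (f * g) - fscale f (fd g) - fscale g (fd f) | f g. True} \<union>
      {fd (ff_const \<phi> c) | c. True}"
  then show "z_coeff \<zeta> = 0"
  proof (elim UnE CollectE exE conjE)
    fix c assume "\<zeta> = fd (ff_const \<phi> c)"
    then show ?thesis using const_power[of c] by (auto simp: z_coeff_fd deriv_frob)
  qed (simp_all add: z_coeff_diff z_coeff_fd z_coeff_fscale deriv_add deriv_mult)
qed

lemma subspace_relations: "fdiff.subspace (kaehler_relations \<phi>)"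
  unfolding kaehler_relations_def by (rule fdiff.subspace_span)

lemmas relations_add = fdiff.subspace_add[OF subspace_relations]
  and relations_scale = fdiff.subspace_scale[OF subspace_relations]
  and relations_sum = fdiff.subspace_sum[OF subspace_relations]

lemma relation_add: "fd (f + g) - fd f - fd g \<in> kaehler_relations \<phi>"
  and relation_mult: "fd (f * g) - fscale f (fd g) - fscale g (fd f) \<in> kaehler_relations \<phi>"
  unfolding kaehler_relations_def by (rule fdiff.span_base; blast)+

lemma relation_power: "fd (f ^ Suc m) - fscale (of_nat (Suc m) * f ^ m) (fd f) \<in> kaehler_relations \<phi>"
proof (induction m)
  case 0
  then show ?case using fdiff.subspace_0[OF subspace_relations] by simp
next
  case (Suc m)
  have "fd (f ^ Suc (Suc m)) - fscale (of_nat (Suc (Suc m)) * f ^ Suc m) (fd f) =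
    (fd (f * f ^ Suc m) - fscale f (fd (f ^ Suc m)) - fscale (f ^ Suc m) (fd f))
    + fscale f (fd (f ^ Suc m) - fscale (of_nat (Suc m) * f ^ m) (fd f))"
    by (rule poly_mapping_eqI) (simp only: lookup_fscale lookup_add lookup_minus , simp add: algebra_simps)
  then show ?case
    using relations_add[OF relation_mult relations_scale[OF Suc]] by (simp only:)
qed

lemma relation_frob: "fd (f ^ p) \<in> kaehler_relations \<phi>"
proof -
  obtain q where q: "p = Suc q" using p_pos gr0_implies_Suc by blast
  have "(of_nat (Suc q) :: 'f) = 0" using of_nat_eq_0_iff[of p] q by simp
  then have "fscale (of_nat (Suc q) * f ^ q) (fd f) = 0"
    by (simp only: mult_zero_left fdiff.scale_zero_left)
  then show ?thesis using relation_power[of f q] q by simp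
qed

text \<open>The elements \<open>g\<close> for which \<open>dg = g' dz\<close> holds modulo the relations form a ring that contains \<open>z\<close> and, by
  \<open>relation_frob\<close>, all \<open>p\<close>-th powers; this ring is everything.\<close>

lemma fd_eq_deriv: "fd g - fscale (deriv g) (fd z) \<in> kaehler_relations \<phi>"
proof -
  define S where "S = {g. fd g - fscale (deriv g) (fd z) \<in> kaehler_relations \<phi>}"
  have S_add: "f + g \<in> S" if "f \<in> S" "g \<in> S" for f g
  proof -
    have "fd (f + g) - fscale (deriv (f + g)) (fd z) =
      (fd (f + g) - fd f - fd g)
      + ((fd f - fscale (deriv f) (fd z)) + (fd g - fscale (deriv g) (fd z)))"
      by (rule poly_mapping_eqI) (simp only: lookup_fscale lookup_add lookup_minus deriv_add, simp add: algebra_simps)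
    then show ?thesis unfolding S_def mem_Collect_eq
      using that by (simp only: S_def mem_Collect_eq) (intro relations_add relation_add)
  qed
  have S_mult: "f * g \<in> S" if "f \<in> S" "g \<in> S" for f g
  proof -
    have "fd (f * g) - fscale (deriv (f * g)) (fd z) =
      (fd (f * g) - fscale f (fd g) - fscale g (fd f))
      + (fscale f (fd g - fscale (deriv g) (fd z)) + fscale g (fd f - fscale (deriv f) (fd z)))"
      by (rule poly_mapping_eqI) (simp only: lookup_fscale lookup_add lookup_minus deriv_mult, simp add: algebra_simps)
    then show ?thesis unfolding S_def mem_Collect_eq
      using that by (simp only: S_def mem_Collect_eq) (intro relations_add relations_scale relation_mult)
  qed
  have S_frob: "f ^ p \<in> S" for f
    using relation_frob by (simp add: S_def deriv_frob)
  have S_z: "z \<in> S"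
    using fdiff.subspace_0[OF subspace_relations] by (simp add: S_def deriv_z)
  have S_zm: "z ^ m \<in> S" for m
    by (induction m) (use S_frob[of 1] in \<open>auto intro: S_mult S_z\<close>)
  have S_0: "0 \<in> S" using S_frob[of 0] by (simp add: frob_0)
  have "(\<Sum>i\<in>A. coord g i ^ p * z ^ i) \<in> S" for A
    by (induction A rule: infinite_finite_induct) (auto intro: S_0 S_add S_mult S_frob S_zm)
  then have "g \<in> S" using coord_expand[of g] by metis
  then show ?thesis by (simp add: S_def)
qed

lemma formal_diff_expand: "\<zeta> = (\<Sum>g\<in>Poly_Mapping.keys \<zeta>. fscale (Poly_Mapping.lookup \<zeta> g) (fd g))"
  by (rule poly_mapping_eqI)
    (simp add: lookup_sum lookup_fscale fd_def lookup_single when_def in_keys_iff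
      if_distrib[of "\<lambda>a. _ * a"] sum.delta cong: if_cong)

lemma z_coeff_eq_relation: "\<zeta> - fscale (z_coeff \<zeta>) (fd z) \<in> kaehler_relations \<phi>"
proof -
  have "\<zeta> - fscale (z_coeff \<zeta>) (fd z) =
    (\<Sum>g\<in>Poly_Mapping.keys \<zeta>. fscale (Poly_Mapping.lookup \<zeta> g) (fd g - fscale (deriv g) (fd z)))"
    by (subst (1) formal_diff_expand[of \<zeta>])
      (simp add: z_coeff_def fdiff.scale_right_diff_distrib sum_subtractf fdiff.scale_sum_left)
  then show ?thesis
    by (simp only:) (intro relations_sum relations_scale fd_eq_deriv)
qed

lemma relations_iff: "\<zeta> \<in> kaehler_relations \<phi> \<longleftrightarrow> z_coeff \<zeta> = 0"
  using z_coeff_relations z_coeff_eq_relation[of \<zeta>] by auto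

lemma one_form_eq_iff: "one_form \<phi> \<eta> = one_form \<phi> \<zeta> \<longleftrightarrow> z_coeff \<eta> = z_coeff \<zeta>"
proof
  assume "one_form \<phi> \<eta> = one_form \<phi> \<zeta>"
  moreover have "\<eta> \<in> one_form \<phi> \<eta>"
    using fdiff.subspace_0[OF subspace_relations] by (simp add: one_form_def)
  ultimately show "z_coeff \<eta> = z_coeff \<zeta>" by (auto simp: one_form_def relations_iff z_coeff_diff)
qed (auto simp: one_form_def relations_iff z_coeff_diff)

lemma mem_one_form_iff: "\<zeta> \<in> one_form \<phi> \<eta> \<longleftrightarrow> z_coeff \<zeta> = z_coeff \<eta>"
  by (simp add: one_form_def relations_iff z_coeff_diff)

text \<open>On \<open>dz\<close>-coefficients \<open>cartier\<close> is \<open>cart\<close>, whichever \<open>t\<close> is used. Existence of the expansion in powers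
  of \<open>t\<close> and uniqueness of the value are what the definite description in its definition requires.\<close>

lemma cartier_one_form:
  assumes t: "t \<notin> range (\<lambda>f. f ^ p)" and hol: "one_form \<phi> \<eta> \<in> H10 n X \<phi>"
    and \<zeta>: "z_coeff \<zeta> = cart (z_coeff \<eta>)"
  shows "cartier n X \<phi> t (one_form \<phi> \<eta>) = one_form \<phi> \<zeta>"
proof -
  have dt: "deriv t \<noteq> 0" using deriv_eq_0_imp t by blast
  have iff: "one_form \<phi> \<eta> = one_form \<phi> (fscale (\<Sum>i<p. u i ^ p * t ^ i) (fd t)) \<longleftrightarrow>
      z_coeff \<eta> = (\<Sum>i<p. u i ^ p * t ^ i) * deriv t" for u
    by (simp add: one_form_eq_iff z_coeff_fscale z_coeff_fd)
  have expansion_value: "one_form \<phi> (fscale (u (p - 1)) (fd t)) = one_form \<phi> \<zeta>"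
    if "z_coeff \<eta> = (\<Sum>i<p. u i ^ p * t ^ i) * deriv t" for u
    using that \<zeta> cart_expansion[of u t] by (simp add: one_form_eq_iff z_coeff_fscale z_coeff_fd)
  obtain u where "z_coeff \<eta> / deriv t = (\<Sum>i<p. u i ^ p * t ^ i)"
    using spanning_change[OF t] by blast
  then have u: "z_coeff \<eta> = (\<Sum>i<p. u i ^ p * t ^ i) * deriv t"
    using dt by (metis nonzero_divide_eq_eq)
  have "(THE \<omega>. \<exists>u. one_form \<phi> \<eta> = one_form \<phi> (fscale (\<Sum>i<p. u i ^ p * t ^ i) (fd t)) \<and>
     \<omega> = one_form \<phi> (fscale (u (p - 1)) (fd t))) = one_form \<phi> \<zeta>"
    unfolding iff using u expansion_value by (intro the_equality) metis+
  then show ?thesis using hol char_p by (simp add: cartier_def)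
qed

end

section \<open>Evaluation of homogeneous polynomials at projective points\<close>

definition monomial_value :: "(nat \<Rightarrow>\<^sub>0 nat) \<Rightarrow> (nat \<Rightarrow> 'a::comm_ring_1) \<Rightarrow> 'a" where
  "monomial_value m x = (\<Prod>i\<in>Poly_Mapping.keys m. x i ^ Poly_Mapping.lookup m i)"

definition monomial_degree :: "(nat \<Rightarrow>\<^sub>0 nat) \<Rightarrow> nat" where
  "monomial_degree m = (\<Sum>i\<in>Poly_Mapping.keys m. Poly_Mapping.lookup m i)"

lemma monomial_value_superset:
  assumes "finite A" "Poly_Mapping.keys m \<subseteq> A"
  shows "monomial_value m x = (\<Prod>i\<in>A. x i ^ Poly_Mapping.lookup m i)"
  unfolding monomial_value_def using assms by (intro prod.mono_neutral_left) (auto simp: in_keys_iff)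

lemma monomial_degree_superset:
  assumes "finite A" "Poly_Mapping.keys m \<subseteq> A"
  shows "monomial_degree m = (\<Sum>i\<in>A. Poly_Mapping.lookup m i)"
  unfolding monomial_degree_def using assms by (intro sum.mono_neutral_left) (auto simp: in_keys_iff)

lemma keys_add_nat:
  fixes m m' :: "'b \<Rightarrow>\<^sub>0 nat"
  shows "Poly_Mapping.keys (m + m') = Poly_Mapping.keys m \<union> Poly_Mapping.keys m'"
  by (auto simp: in_keys_iff lookup_add)

lemma monomial_value_add: "monomial_value (m + m') x = monomial_value m x * monomial_value m' x"
proof -
  let ?A = "Poly_Mapping.keys m \<union> Poly_Mapping.keys m'"
  have fin: "finite ?A" by simp
  have "Poly_Mapping.keys m \<subseteq> ?A" "Poly_Mapping.keys m' \<subseteq> ?A"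
    "Poly_Mapping.keys (m + m') \<subseteq> ?A"
    by (auto simp: keys_add_nat)
  note this[THEN monomial_value_superset[OF fin, where x = x]]
  then show ?thesis by (simp add: lookup_add power_add prod.distrib)
qed

lemma monomial_degree_add: "monomial_degree (m + m') = monomial_degree m + monomial_degree m'"
proof -
  let ?A = "Poly_Mapping.keys m \<union> Poly_Mapping.keys m'"
  have fin: "finite ?A" by simp
  have "Poly_Mapping.keys m \<subseteq> ?A" "Poly_Mapping.keys m' \<subseteq> ?A"
    "Poly_Mapping.keys (m + m') \<subseteq> ?A"
    by (auto simp: keys_add_nat)
  note this[THEN monomial_degree_superset[OF fin]]
  then show ?thesis by (simp add: lookup_add sum.distrib)
qed

lemma monomial_value_scale:
  "monomial_value m (\<lambda>i. c * x i) = c ^ monomial_degree m * monomial_value m x"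
  by (simp add: monomial_value_def monomial_degree_def power_mult_distrib prod.distrib power_sum)

lemma peval_superset:
  assumes "finite A" "Poly_Mapping.keys F \<subseteq> A"
  shows "peval F x = (\<Sum>m\<in>A. Poly_Mapping.lookup F m * monomial_value m x)"
  unfolding peval_def monomial_value_def[symmetric] using assms
  by (intro sum.mono_neutral_left) (auto simp: in_keys_iff)

lemma peval_0: "peval 0 x = 0"
  by (simp add: peval_def)

lemma peval_single: "peval (Poly_Mapping.single m c) x = c * monomial_value m x"
  by (subst peval_superset[of "{m}"]) auto

lemma peval_add: "peval (F + G) x = peval F x + peval G x"
proof -
  let ?A = "Poly_Mapping.keys F \<union> Poly_Mapping.keys G"
  have fin: "finite ?A" by simp
  have "Poly_Mapping.keys F \<subseteq> ?A" "Poly_Mapping.keys G \<subseteq> ?A" "Poly_Mapping.keys (F + G) \<subseteq> ?A"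
    by (auto simp: keys_add)
  note this[THEN peval_superset[OF fin, where x = x]]
  then show ?thesis by (simp add: lookup_add distrib_right sum.distrib)
qed

lemma peval_sum: "peval (\<Sum>i\<in>A. f i) x = (\<Sum>i\<in>A. peval (f i) x)"
  by (induction A rule: infinite_finite_induct) (auto simp: peval_0 peval_add)

lemma mpoly_expand: "F = (\<Sum>m\<in>Poly_Mapping.keys F. Poly_Mapping.single m (Poly_Mapping.lookup F m))"
  by (rule poly_mapping_eqI) (simp add: lookup_sum lookup_single when_def in_keys_iff sum.delta)

lemma peval_mult: "peval (F * G) x = peval F x * peval G x"
proof -
  let ?s = "\<lambda>F m. Poly_Mapping.single m (Poly_Mapping.lookup F m)"
  have "F * G = (\<Sum>m\<in>Poly_Mapping.keys F. ?s F m) * (\<Sum>m\<in>Poly_Mapping.keys G. ?s G m)"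
    using mpoly_expand[of F] mpoly_expand[of G] by simp
  then have "peval (F * G) x = (\<Sum>m\<in>Poly_Mapping.keys F. \<Sum>m'\<in>Poly_Mapping.keys G.
      peval (?s F m) x * peval (?s G m') x)"
    by (simp add: sum_product peval_sum mult_single peval_single monomial_value_add mult_ac)
  also have "\<dots> = (\<Sum>m\<in>Poly_Mapping.keys F. peval (?s F m) x) * (\<Sum>m\<in>Poly_Mapping.keys G. peval (?s G m) x)"
    by (simp add: sum_product)
  also have "\<dots> = peval F x * peval G x"
    by (simp only: peval_single) (simp add: peval_def monomial_value_def)
  finally show ?thesis .
qed

lemma peval_pconst: "peval (pconst c) x = c"
  by (simp add: pconst_def peval_single monomial_value_def)

lemma peval_1: "peval 1 x = 1"
  using peval_pconst[of 1 x] by (simp add: pconst_def)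

lemma peval_pvar: "peval (pvar i) x = x i"
  by (simp add: pvar_def peval_single monomial_value_def)

lemma peval_power: "peval (F ^ d) x = peval F x ^ d"
  by (induction d) (auto simp: peval_1 peval_mult)

lemma pconst_0: "pconst 0 = 0" and pconst_1: "pconst 1 = 1"
  by (simp_all add: pconst_def)

lemma pconst_add: "pconst (a + b) = pconst a + pconst b"
  by (simp add: pconst_def single_add)

lemma pconst_mult: "pconst (a * b) = pconst a * pconst b"
  by (simp add: pconst_def mult_single)

lemma forms_iff: "F \<in> forms n d \<longleftrightarrow> (\<forall>m\<in>Poly_Mapping.keys F. Poly_Mapping.keys m \<subseteq> {1..n+1} \<and> monomial_degree m = d)"
  by (simp add: forms_def monomial_degree_def)

lemma forms_0: "0 \<in> forms n d"
  by (simp add: forms_iff)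

lemma forms_add: "F \<in> forms n d \<Longrightarrow> G \<in> forms n d \<Longrightarrow> F + G \<in> forms n d"
  using keys_add[of F G] unfolding forms_iff by blast

lemma forms_mult: "F \<in> forms n d \<Longrightarrow> G \<in> forms n e \<Longrightarrow> F * G \<in> forms n (d + e)"
  using keys_mult[of F G] unfolding forms_iff
  by (fastforce simp: keys_add_nat monomial_degree_add)

lemma forms_pconst: "pconst c \<in> forms n 0"
  by (auto simp: forms_iff pconst_def monomial_degree_def)

lemma forms_1: "1 \<in> forms n 0"
  using forms_pconst[of 1] by (simp add: pconst_1)

lemma forms_pvar: "i \<in> {1..n+1} \<Longrightarrow> pvar i \<in> forms n 1"
  by (auto simp: forms_iff pvar_def monomial_degree_def)

lemma forms_power: "F \<in> forms n d \<Longrightarrow> F ^ e \<in> forms n (e * d)"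
  by (induction e) (auto intro: forms_1 forms_mult)

lemma peval_scale: "F \<in> forms n d \<Longrightarrow> peval F (\<lambda>i. c * x i) = c ^ d * peval F x"
  unfolding peval_def monomial_value_def[symmetric] monomial_value_scale sum_distrib_left
  by (intro sum.cong) (auto simp: forms_iff)

text \<open>By homogeneity one representative of the point decides.\<close>

lemma vanishes_at_iff:
  assumes P: "P \<in> proj_space n" and x: "x \<in> P" and F: "F \<in> forms n d"
  shows "vanishes_at F P \<longleftrightarrow> peval F x = 0"
proof -
  obtain x0 where P_eq: "P = {(\<lambda>i. c * x0 i) | c. c \<noteq> 0}"
    using P by (auto simp: proj_space_def)
  obtain a where a: "a \<noteq> 0" "x = (\<lambda>i. a * x0 i)" using x P_eq by blast
  show ?thesis
    unfolding vanishes_at_def P_eq using a by (auto simp: peval_scale[OF F])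
qed

lemma proj_space_rep:
  assumes "P \<in> proj_space n"
  obtains x where "x \<in> P" "\<exists>i\<in>{1..n+1}. x i \<noteq> 0"
proof -
  obtain x where P: "P = {(\<lambda>i. c * x i) | c. c \<noteq> 0}" and x: "\<forall>i. i \<notin> {1..n+1} \<longrightarrow> x i = 0" "\<exists>i. x i \<noteq> 0"
    using assms by (auto simp: proj_space_def)
  have "x \<in> P" unfolding P by (auto intro!: exI[of _ 1])
  moreover have "\<exists>i\<in>{1..n+1}. x i \<noteq> 0" using x by blast
  ultimately show ?thesis using that by blast
qed

lemma vanishes_at_mult_iff:
  assumes "P \<in> proj_space n" "F \<in> forms n d" "G \<in> forms n e"
  shows "vanishes_at (F * G) P \<longleftrightarrow> vanishes_at F P \<or> vanishes_at G P"
proof -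
  obtain x where "x \<in> P" using proj_space_rep assms(1) by blast
  then show ?thesis using assms
    by (simp add: vanishes_at_iff[of _ n] vanishes_at_iff[OF _ _ forms_mult[of _ n d _ e]] peval_mult)
qed

section \<open>The function field of a projective variety\<close>

locale projective_function_field =
  fixes n :: nat and X :: "'a::field ppoint set" and \<phi> :: "'a mpoly \<Rightarrow> 'a mpoly \<Rightarrow> 'f::field"
  assumes ff: "function_field n X \<phi>"
    and X_proj: "X \<subseteq> proj_space n"
    and pvar_1: "\<not> vanishes_on (pvar 1) X"
begin

lemma phi_eq_iff:
  assumes "(G, H) \<in> fractions n X" "(G', H') \<in> fractions n X"
  shows "\<phi> G H = \<phi> G' H' \<longleftrightarrow> vanishes_on (G * H' - G' * H) X"
    and phi_add: "\<phi> (G * H' + G' * H) (H * H') = \<phi> G H + \<phi> G' H'"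
    and phi_mult: "\<phi> (G * G') (H * H') = \<phi> G H * \<phi> G' H'"
  using ff assms unfolding function_field_def by blast+

lemma fractionsI: "G \<in> forms n d \<Longrightarrow> H \<in> forms n d \<Longrightarrow> \<not> vanishes_on H X \<Longrightarrow> (G, H) \<in> fractions n X"
  by (auto simp: fractions_def)

lemma vanishes_on_0: "vanishes_on 0 X"
  by (simp add: vanishes_on_def vanishes_at_def peval_0)

lemma pvar_1_form: "pvar 1 \<in> forms n 1"
  by (rule forms_pvar) simp

lemma pvar_1_power_form: "pvar 1 ^ d \<in> forms n d"
  using forms_power[OF pvar_1_form, of d] by simp

lemma pvar_1_power: "\<not> vanishes_on (pvar 1 ^ d) X"
  using pvar_1 unfolding vanishes_on_def vanishes_at_def peval_power by (metis power_eq_0_iff)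

text \<open>The class of a form of degree \<open>d\<close> in the affine chart \<open>x\<^sub>1 = 1\<close>. All computations in the function field are
  reduced to it, since \<open>dehom\<close> is additive and multiplicative on forms (\<open>dehom_add\<close>, \<open>dehom_mult\<close>).\<close>

definition dehom :: "nat \<Rightarrow> 'a mpoly \<Rightarrow> 'f" where
  "dehom d G = \<phi> G (pvar 1 ^ d)"

lemma dehom_fraction: "G \<in> forms n d \<Longrightarrow> (G, pvar 1 ^ d) \<in> fractions n X"
  by (rule fractionsI[OF _ pvar_1_power_form pvar_1_power])

lemma one_not_vanishes: "\<not> vanishes_on 1 X"
  using pvar_1_power[of 0] by simp

lemma phi_cancel:
  assumes "(G, H) \<in> fractions n X" "(G', H') \<in> fractions n X" "G * H' = G' * H"
  shows "\<phi> G H = \<phi> G' H'"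
  using assms by (simp add: phi_eq_iff vanishes_on_0)

lemma dehom_mult: "G \<in> forms n d \<Longrightarrow> G' \<in> forms n e \<Longrightarrow> dehom (d + e) (G * G') = dehom d G * dehom e G'"
  unfolding dehom_def power_add by (intro phi_mult dehom_fraction)

lemma dehom_add:
  assumes "G \<in> forms n d" "G' \<in> forms n d"
  shows "dehom d (G + G') = dehom d G + dehom d G'"
proof -
  let ?H = "pvar 1 ^ d :: 'a mpoly"
  have "\<phi> (G + G') ?H = \<phi> (G * ?H + G' * ?H) (?H * ?H)"
  proof (rule phi_cancel)
    show "(G + G', ?H) \<in> fractions n X" by (intro dehom_fraction forms_add assms)
    show "(G * ?H + G' * ?H, ?H * ?H) \<in> fractions n X"
      using dehom_fraction[OF forms_add[OF assms[THEN forms_mult[OF _ pvar_1_power_form]]]]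
      by (simp only: power_add)
  qed (simp add: algebra_simps)
  then show ?thesis using phi_add[OF assms[THEN dehom_fraction]] by (simp add: dehom_def)
qed

lemma dehom_0: "dehom d 0 = 0"
  using dehom_add[of 0 d 0] forms_0 by (metis add_0 add_cancel_right_right)

lemma dehom_eq_0_iff: "G \<in> forms n d \<Longrightarrow> dehom d G = 0 \<longleftrightarrow> vanishes_on G X"
  using phi_eq_iff[OF dehom_fraction[of G d] dehom_fraction[of 0 0]] dehom_0[of 0]
  by (simp add: dehom_def forms_0)

lemma dehom_1: "dehom 0 1 = 1"
proof -
  have "dehom 0 1 * dehom 0 1 = dehom 0 1" using dehom_mult[OF forms_1 forms_1] by simp
  moreover have "dehom 0 1 \<noteq> 0" using dehom_eq_0_iff[of 1 0] forms_1 one_not_vanishes by blast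
  ultimately show ?thesis by simp
qed

text \<open>The ideal of \<open>X\<close> is prime because the function field has no zero divisors. The argument is not circular:
  denominators \<open>x\<^sub>1 ^ d\<close> are harmless pointwise, so \<open>dehom\<close> is multiplicative before irreducibility is known.\<close>

lemma nonvanishing_mult:
  assumes "H \<in> forms n d" "H' \<in> forms n e" "\<not> vanishes_on H X" "\<not> vanishes_on H' X"
  shows "\<not> vanishes_on (H * H') X"
  using dehom_mult[OF assms(1,2)] dehom_eq_0_iff[OF assms(1)] dehom_eq_0_iff[OF assms(2)]
    dehom_eq_0_iff[OF forms_mult[OF assms(1,2)]] assms(3,4) by simp

lemma phi_eq_divide:
  assumes G: "G \<in> forms n d" and H: "H \<in> forms n d" and nv: "\<not> vanishes_on H X"
  shows "\<phi> G H = dehom d G / dehom d H"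
proof -
  have "\<phi> G H * dehom d H = \<phi> (G * H) (H * pvar 1 ^ d)"
    unfolding dehom_def using G H nv by (intro phi_mult[symmetric] fractionsI dehom_fraction) auto
  also have "\<dots> = dehom d G"
    unfolding dehom_def
  proof (rule phi_cancel)
    show "(G * H, H * pvar 1 ^ d) \<in> fractions n X"
      using G H nv
      by (intro fractionsI[of _ "d + d"] forms_mult nonvanishing_mult[of _ d _ d] pvar_1_power_form pvar_1_power)
    show "(G, pvar 1 ^ d) \<in> fractions n X" by (rule dehom_fraction[OF G])
  qed (simp add: mult_ac)
  finally show ?thesis using dehom_eq_0_iff[OF H] nv by (simp add: nonzero_eq_divide_eq)
qed

lemma ff_const_eq: "ff_const \<phi> c = dehom 0 (pconst c)"
  by (simp add: ff_const_def dehom_def)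

lemma ff_const_add: "ff_const \<phi> (a + b) = ff_const \<phi> a + ff_const \<phi> b"
  by (simp add: ff_const_eq pconst_add dehom_add forms_pconst)

lemma ff_const_mult: "ff_const \<phi> (a * b) = ff_const \<phi> a * ff_const \<phi> b"
  using dehom_mult[OF forms_pconst forms_pconst, of a b] by (simp add: ff_const_eq pconst_mult)

lemma ff_const_0: "ff_const \<phi> 0 = 0"
  by (simp add: ff_const_eq pconst_0 dehom_0)

lemma ff_const_1: "ff_const \<phi> 1 = 1"
  by (simp add: ff_const_eq pconst_1 dehom_1)

lemma ff_const_eq_0_iff: "ff_const \<phi> c = 0 \<longleftrightarrow> c = 0"
  by (metis ff_const_0 ff_const_1 ff_const_mult mult_zero_left right_inverse zero_neq_one)

lemma ff_const_minus: "ff_const \<phi> (- a) = - ff_const \<phi> a"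
  using ff_const_add[of "- a" a] by (simp add: ff_const_0 eq_neg_iff_add_eq_0)

lemma ff_const_power: "ff_const \<phi> (a ^ m) = ff_const \<phi> a ^ m"
  by (induction m) (auto simp: ff_const_1 ff_const_mult)

lemma ff_const_of_nat: "ff_const \<phi> (of_nat m) = of_nat m"
  by (induction m) (auto simp: ff_const_0 ff_const_1 ff_const_add)

lemma CHAR_function_field: "CHAR('f) = CHAR('a)"
proof (rule CHAR_eqI)
  show "of_nat CHAR('a) = (0::'f)" using ff_const_of_nat[of "CHAR('a)"] by (simp add: ff_const_0)
next
  fix m assume "of_nat m = (0::'f)"
  then have "of_nat m = (0::'a)" using ff_const_of_nat[of m] ff_const_eq_0_iff by metis
  then show "CHAR('a) dvd m" by (simp add: of_nat_eq_0_iff_char_dvd)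
qed

lemma ycoord_eq: "ycoord \<phi> j = dehom 1 (pvar j)"
  by (simp add: ycoord_def dehom_def)

lemma ycoord_1: "ycoord \<phi> 1 = 1"
  unfolding ycoord_def using phi_eq_divide[OF pvar_1_form pvar_1_form pvar_1]
    dehom_eq_0_iff[OF pvar_1_form] pvar_1 by simp

lemma ycoord_nonzero: "j \<in> {1..n+1} \<Longrightarrow> \<not> vanishes_on (pvar j) X \<Longrightarrow> ycoord \<phi> j \<noteq> 0"
  using dehom_eq_0_iff[OF forms_pvar] by (simp add: ycoord_eq)

lemma ycoord_power: "j \<in> {1..n+1} \<Longrightarrow> dehom d (pvar j ^ d) = ycoord \<phi> j ^ d"
proof (induction d)
  case (Suc d)
  then show ?case
    using dehom_mult[OF forms_pvar[of j n] forms_power[OF forms_pvar[of j n], of d]]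
    by (simp add: ycoord_eq)
qed (simp add: dehom_1)

lemma ycoord_relation:
  assumes van: "vanishes_on (pconst c * pvar 1 ^ k + pvar 2 ^ k + pvar j ^ k) X"
    and j: "j \<in> {1..n+1}" and n: "1 \<le> n"
  shows "ff_const \<phi> c + ycoord \<phi> 2 ^ k + ycoord \<phi> j ^ k = 0"
proof -
  have f: "pvar i ^ k \<in> forms n k" if "i \<in> {1..n+1}" for i
    using forms_power[OF forms_pvar[OF that], of k] by simp
  have 2: "2 \<in> {1..n+1}" and 1: "1 \<in> {1..n+1}" using n by auto
  have c: "pconst c * pvar 1 ^ k \<in> forms n k"
    using forms_mult[OF forms_pconst f[OF 1]] by simp
  have "dehom k (pconst c * pvar 1 ^ k) = ff_const \<phi> c"
    using dehom_mult[OF forms_pconst f[OF 1], of c] ycoord_power[OF 1, of k]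
    by (simp add: ff_const_eq ycoord_1[unfolded One_nat_def])
  then have "dehom k (pconst c * pvar 1 ^ k + pvar 2 ^ k + pvar j ^ k)
      = ff_const \<phi> c + ycoord \<phi> 2 ^ k + ycoord \<phi> j ^ k"
    using dehom_add[OF forms_add[OF c f[OF 2]] f[OF j]] dehom_add[OF c f[OF 2]]
    by (simp only: ycoord_power[OF 2] ycoord_power[OF j])
  moreover have "dehom k (pconst c * pvar 1 ^ k + pvar 2 ^ k + pvar j ^ k) = 0"
    using van dehom_eq_0_iff[OF forms_add[OF forms_add[OF c f[OF 2]] f[OF j]]] by simp
  ultimately show ?thesis by simp
qed

text \<open>Subfields that contain the constants and the affine coordinates are everything; the proof builds
  a form from monomials, and a monomial one variable at a time.\<close>

lemma function_field_generated:
  assumes const: "\<And>c. ff_const \<phi> c \<in> S" and coord: "\<And>j. j \<in> {1..n+1} \<Longrightarrow> ycoord \<phi> j \<in> S"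
    and add: "\<And>f g. f \<in> S \<Longrightarrow> g \<in> S \<Longrightarrow> f + g \<in> S"
    and mult: "\<And>f g. f \<in> S \<Longrightarrow> g \<in> S \<Longrightarrow> f * g \<in> S"
    and inv: "\<And>f. f \<in> S \<Longrightarrow> f \<noteq> 0 \<Longrightarrow> inverse f \<in> S"
  shows "f \<in> S"
proof -
  have single: "dehom (monomial_degree m) (Poly_Mapping.single m c) \<in> S \<and>
      Poly_Mapping.single m c \<in> forms n (monomial_degree m)"
    if "Poly_Mapping.keys m \<subseteq> {1..n+1}" for m and c :: 'a
    using that
  proof (induction "monomial_degree m" arbitrary: m)
    case 0
    then have "m = 0"
      by (intro poly_mapping_eqI) (auto simp: monomial_degree_def in_keys_iff)
    then have "Poly_Mapping.single m c = pconst c" "monomial_degree m = 0"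
      by (simp_all add: pconst_def monomial_degree_def)
    then show ?case using const[of c] forms_pconst by (simp add: ff_const_eq)
  next
    case (Suc d)
    then obtain i where i: "i \<in> Poly_Mapping.keys m"
      by (metis monomial_degree_def nat.distinct(1) sum.neutral)
    define e where "e = Poly_Mapping.single i (1::nat)"
    define m' where "m' = m - e"
    have m: "m = m' + e"
      using i by (intro poly_mapping_eqI)
        (auto simp: m'_def e_def lookup_add lookup_minus lookup_single when_def in_keys_iff)
    have deg: "monomial_degree m = monomial_degree m' + 1"
      by (simp add: m monomial_degree_add) (simp add: e_def monomial_degree_def)
    have keys: "Poly_Mapping.keys m' \<subseteq> {1..n+1}" using Suc.prems by (simp add: m keys_add_nat)
    have IH: "dehom (monomial_degree m') (Poly_Mapping.single m' c) \<in> S"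
      "Poly_Mapping.single m' c \<in> forms n (monomial_degree m')"
      using Suc.hyps(1)[OF _ keys] Suc.hyps(2) deg by auto
    have i': "i \<in> {1..n+1}" using i Suc.prems by blast
    have "Poly_Mapping.single m c = Poly_Mapping.single m' c * pvar i"
      by (simp add: pvar_def mult_single m e_def)
    then show ?case
      using dehom_mult[OF IH(2) forms_pvar[OF i']] mult[OF IH(1) coord[OF i']]
        forms_mult[OF IH(2) forms_pvar[OF i']] deg by (simp add: ycoord_eq)
  qed
  have dehom_S: "dehom d G \<in> S" if G: "G \<in> forms n d" for d G
  proof -
    have "dehom d (\<Sum>m\<in>A. Poly_Mapping.single m (Poly_Mapping.lookup G m)) \<in> S \<and>
      (\<Sum>m\<in>A. Poly_Mapping.single m (Poly_Mapping.lookup G m)) \<in> forms n d"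
      if "finite A" "A \<subseteq> Poly_Mapping.keys G" for A
      using that
    proof (induction A)
      case empty
      then show ?case using const[of 0] forms_0 by (simp add: dehom_0 ff_const_0)
    next
      case (insert m A)
      then have "dehom d (Poly_Mapping.single m (Poly_Mapping.lookup G m)) \<in> S"
        "Poly_Mapping.single m (Poly_Mapping.lookup G m) \<in> forms n d"
        using single[of m "Poly_Mapping.lookup G m"] G by (auto simp: forms_iff)
      then show ?case using insert by (simp add: dehom_add add forms_add)
    qed
    from this[of "Poly_Mapping.keys G"] show ?thesis using mpoly_expand[of G] by simp
  qed
  obtain G H d where f: "f = \<phi> G H" and GH: "G \<in> forms n d" "H \<in> forms n d" "\<not> vanishes_on H X"
    using ff unfolding function_field_def fractions_def by fast
  then have "f = dehom d G * inverse (dehom d H)" "dehom d H \<noteq> 0"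
    using phi_eq_divide dehom_eq_0_iff by (auto simp: divide_inverse)
  then show ?thesis using GH dehom_S by (simp add: mult inv)
qed

lemma local_ring_mult:
  assumes P: "P \<in> X" and fg: "f \<in> local_ring n X \<phi> P" "g \<in> local_ring n X \<phi> P"
  shows "f * g \<in> local_ring n X \<phi> P"
proof -
  obtain G H d where f: "f = \<phi> G H" "G \<in> forms n d" "H \<in> forms n d" "\<not> vanishes_on H X" "\<not> vanishes_at H P"
    using fg(1) unfolding local_ring_def fractions_def by blast
  obtain G' H' e where g: "g = \<phi> G' H'" "G' \<in> forms n e" "H' \<in> forms n e" "\<not> vanishes_on H' X" "\<not> vanishes_at H' P"
    using fg(2) unfolding local_ring_def fractions_def by blast
  have "f * g = \<phi> (G * G') (H * H')" unfolding f(1) g(1)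
    using f g by (intro phi_mult[symmetric] fractionsI) auto
  moreover have nv: "\<not> vanishes_at (H * H') P"
    using vanishes_at_mult_iff[OF _ f(3) g(3)] f g X_proj P by blast
  moreover have "(G * G', H * H') \<in> fractions n X"
    using f g nv P by (intro fractionsI[of _ "d + e"] forms_mult) (auto simp: vanishes_on_def)
  ultimately show ?thesis unfolding local_ring_def by blast
qed

lemma local_ring_const:
  assumes "P \<in> X"
  shows "ff_const \<phi> c \<in> local_ring n X \<phi> P"
proof -
  obtain x where "x \<in> P" using assms X_proj proj_space_rep by blast
  then have "\<not> vanishes_at 1 P" by (auto simp: vanishes_at_def peval_1)
  then show ?thesis
    unfolding local_ring_def ff_const_def
    using fractionsI[OF forms_pconst forms_1 one_not_vanishes] by blast
qed

lemma local_ring_power: "P \<in> X \<Longrightarrow> f \<in> local_ring n X \<phi> P \<Longrightarrow> f ^ m \<in> local_ring n X \<phi> P"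
  by (induction m) (use local_ring_const[of P 1] in \<open>auto simp: ff_const_1 local_ring_mult\<close>)

lemma local_ring_prod:
  "P \<in> X \<Longrightarrow> (\<And>i. i \<in> A \<Longrightarrow> f i \<in> local_ring n X \<phi> P) \<Longrightarrow> (\<Prod>i\<in>A. f i) \<in> local_ring n X \<phi> P"
  by (induction A rule: infinite_finite_induct)
    (use local_ring_const[of P 1] in \<open>auto simp: ff_const_1 local_ring_mult\<close>)

lemma local_ring_minus: "P \<in> X \<Longrightarrow> f \<in> local_ring n X \<phi> P \<Longrightarrow> - f \<in> local_ring n X \<phi> P"
  using local_ring_mult[OF _ local_ring_const[of P "- 1"], of f] by (simp add: ff_const_minus ff_const_1)

lemma local_ring_coord:
  assumes P: "P \<in> X" and ij: "i \<in> {1..n+1}" "j \<in> {1..n+1}" and nv: "\<not> vanishes_at (pvar j) P"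
  shows "ycoord \<phi> i / ycoord \<phi> j \<in> local_ring n X \<phi> P"
proof -
  have nvX: "\<not> vanishes_on (pvar j) X" using P nv unfolding vanishes_on_def by blast
  have "ycoord \<phi> i / ycoord \<phi> j = \<phi> (pvar i) (pvar j)"
    by (simp only: phi_eq_divide[OF ij[THEN forms_pvar] nvX] ycoord_eq)
  moreover have "(pvar i, pvar j) \<in> fractions n X"
    by (rule fractionsI[OF ij[THEN forms_pvar] nvX])
  ultimately show ?thesis using nv unfolding local_ring_def by blast
qed

end

section \<open>The generalized Fermat curve\<close>

locale generalized_fermat =
  fixes p n k :: nat and lam :: "nat \<Rightarrow> 'a::alg_closed_field"
    and \<phi> :: "'a mpoly \<Rightarrow> 'a mpoly \<Rightarrow> 'f::field" and t :: 'f
  assumes char: "CHAR('a) = p" "p \<ge> 3"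
    and n: "n \<ge> 2" and k: "k \<ge> 2" "k dvd p - 1"
    and lams: "\<forall>i\<in>{1..n-2}. lam i \<notin> {0, 1}" "inj_on lam {1..n-2}"
    and lam_0: "lam 0 = 1"
    and ff: "function_field n (gf_curve k n lam) \<phi>"
    and t: "t \<notin> range (\<lambda>f::'f. f ^ p)"
begin

abbreviation X where "X \<equiv> gf_curve k n lam"

lemma prime_p: "prime p"
  using prime_CHAR_semidom[where ?'a = 'a] char by simp

sublocale frob_a: frobenius p "TYPE('a)"
  by unfold_locales (use char prime_p in auto)

lemma proot_power: "proot p c ^ p = (c :: 'a)"
proof -
  obtain b where b: "b ^ p = c" using nth_root_exists[of p c] frob_a.p_pos by blast
  then have "proot p c = b" unfolding proot_def by (intro the_equality) (auto simp: frob_a.frob_inj)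
  then show ?thesis using b by simp
qed

lemma lam_nonzero: "i \<le> n - 2 \<Longrightarrow> lam i \<noteq> 0"
  using lams(1) lam_0 by (cases "i = 0") auto

lemma lam_inj: "i \<le> n - 2 \<Longrightarrow> j \<le> n - 2 \<Longrightarrow> lam i = lam j \<Longrightarrow> i = j"
proof -
  assume ij: "i \<le> n - 2" "j \<le> n - 2" "lam i = lam j"
  have not1: "lam i \<noteq> 1" if "i \<in> {1..n-2}" for i using lams(1) that by auto
  consider "i = 0" | "j = 0" | "i \<in> {1..n-2}" "j \<in> {1..n-2}" using ij by fastforce
  then show ?thesis
  proof cases
    case 1 then show ?thesis using not1[of j] ij lam_0 by (cases "j = 0") auto
  next
    case 2 then show ?thesis using not1[of i] ij lam_0 by (cases "i = 0") auto
  next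
    case 3 then show ?thesis using ij lams(2) by (auto dest: inj_onD)
  qed
qed

text \<open>With \<open>\<lambda>\<^sub>0 = 1\<close> the first equation of the curve has the same shape as the others.\<close>

definition equation :: "nat \<Rightarrow> 'a mpoly" where
  "equation j = pconst (lam (j - 3)) * pvar 1 ^ k + pvar 2 ^ k + pvar j ^ k"

lemma peval_equation: "peval (equation j) x = lam (j - 3) * x 1 ^ k + x 2 ^ k + x j ^ k"
  by (simp add: equation_def peval_add peval_mult peval_power peval_pvar peval_pconst)

lemma curve_iff: "P \<in> X \<longleftrightarrow> P \<in> proj_space n \<and> (\<forall>j\<in>{3..n+1}. vanishes_at (equation j) P)"
proof -
  have "{3..n+1} = insert 3 ((\<lambda>i. i + 3) ` {1..n-2})"
  proof (intro equalityI subsetI)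
    fix j assume "j \<in> {3..n+1}"
    then show "j \<in> insert 3 ((\<lambda>i. i + 3) ` {1..n-2})"
      by (cases "j = 3") (auto intro!: image_eqI[of _ _ "j - 3"])
  qed (use n in auto)
  then have "(\<forall>j\<in>{3..n+1}. Q j) \<longleftrightarrow> Q 3 \<and> (\<forall>i\<in>{1..n-2}. Q (i + 3))" for Q
    by (simp only:) blast
  then show ?thesis
    by (simp only:) (simp add: gf_curve_def equation_def lam_0 pconst_1)
qed

text \<open>The remaining coordinates are \<open>k\<close>-th roots, which exist in an algebraically closed field. The points over
  \<open>(1, 0)\<close> and \<open>(0, 1)\<close> show that no coordinate vanishes identically on the curve.\<close>

lemma curve_point:
  assumes "a \<noteq> 0 \<or> b \<noteq> 0"
  shows "\<exists>P\<in>X. \<exists>x\<in>P. x 1 = a \<and> x 2 = b \<and>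
    (\<forall>j\<in>{3..n+1}. x j ^ k = - lam (j - 3) * a ^ k - b ^ k)"
proof -
  have "\<exists>y. y ^ k = - lam (j - 3) * a ^ k - b ^ k" for j
    using nth_root_exists[of k] k by simp
  then obtain y where y: "\<And>j. y j ^ k = - lam (j - 3) * a ^ k - b ^ k" by metis
  define x where "x = (\<lambda>i. if i = 1 then a else if i = 2 then b else if i \<in> {3..n+1} then y i else 0)"
  define P where "P = {(\<lambda>i. c * x i) | c. c \<noteq> 0}"
  have x: "x 1 = a" "x 2 = b" "\<And>j. j \<in> {3..n+1} \<Longrightarrow> x j = y j" by (auto simp: x_def)
  have "\<forall>i. i \<notin> {1..n+1} \<longrightarrow> x i = 0" using n by (auto simp: x_def)
  moreover have "\<exists>i. x i \<noteq> 0" using assms x(1,2) by metis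
  ultimately have "P \<in> proj_space n" unfolding proj_space_def P_def by blast
  moreover have "vanishes_at (equation j) P" if j: "j \<in> {3..n+1}" for j
  proof -
    have "lam (j - 3) * x 1 ^ k + x 2 ^ k + x j ^ k = 0"
      using y[of j] x(1,2) x(3)[OF j] by simp
    moreover have "peval (equation j) (\<lambda>i. c * x i) =
        c ^ k * (lam (j - 3) * x 1 ^ k + x 2 ^ k + x j ^ k)" for c
      by (simp add: peval_equation power_mult_distrib algebra_simps)
    ultimately show ?thesis unfolding vanishes_at_def P_def by (auto simp only: mult_zero_right)
  qed
  ultimately have "P \<in> X" by (simp add: curve_iff)
  moreover have "x \<in> P" unfolding P_def by (auto intro!: exI[of _ 1])
  ultimately show ?thesis using x y by (intro bexI[of _ P] bexI[of _ x]) simp_all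
qed

lemma pvar_nonvanishing: "j \<in> {1..n+1} \<Longrightarrow> \<not> vanishes_on (pvar j) X"
proof (cases "j = 1")
  case True
  obtain P x where "P \<in> X" "x \<in> P" "x 1 = 1" using curve_point[of 1 0] one_neq_zero by blast
  then show ?thesis using True
    by (auto simp: vanishes_on_def vanishes_at_def peval_pvar intro!: bexI[of _ P] bexI[of _ x])
next
  case False
  assume j: "j \<in> {1..n+1}"
  obtain P x where P: "P \<in> X" "x \<in> P" "x 2 = 1"
    and x: "\<And>j. j \<in> {3..n+1} \<Longrightarrow> x j ^ k = - lam (j - 3) * 0 ^ k - 1 ^ k"
    using curve_point[of 0 1] one_neq_zero by blast
  have "x j \<noteq> 0"
  proof (cases "j = 2")
    case False
    then have "x j ^ k = - 1" using x[of j] \<open>j \<noteq> 1\<close> j k by simp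
    then show ?thesis using k by (auto simp: power_0_left)
  qed (use P in auto)
  then show ?thesis using P by (auto simp: vanishes_on_def vanishes_at_def peval_pvar)
qed

sublocale projective_function_field n X \<phi>
  by unfold_locales (use ff curve_iff pvar_nonvanishing[of 1] in auto)

abbreviation y where "y j \<equiv> ycoord \<phi> j"

abbreviation z where "z \<equiv> ycoord \<phi> 2"

lemma y_nonzero: "j \<in> {1..n+1} \<Longrightarrow> y j \<noteq> 0"
  by (rule ycoord_nonzero[OF _ pvar_nonvanishing])

lemma z_nonzero: "z \<noteq> 0"
  using y_nonzero[of 2] n by simp

lemma y_power_k: "j \<in> {3..n+1} \<Longrightarrow> y j ^ k = - (z ^ k) - ff_const \<phi> (lam (j - 3))"
proof -
  assume j: "j \<in> {3..n+1}"
  then have "vanishes_on (equation j) X" using curve_iff by (auto simp: vanishes_on_def)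
  then have "ff_const \<phi> (lam (j - 3)) + z ^ k + y j ^ k = 0"
    using ycoord_relation[of "lam (j - 3)" k j] j n by (simp add: equation_def)
  then show ?thesis by (simp add: eq_neg_iff_add_eq_0 algebra_simps)
qed

sublocale frob_f: frobenius p "TYPE('f)"
  by unfold_locales (use char prime_p CHAR_function_field in auto)

lemma const_frob: "ff_const \<phi> c = ff_const \<phi> (proot p c) ^ p"
  by (simp add: proot_power flip: ff_const_power)

text \<open>This is where \<open>k dvd p - 1\<close> enters: \<open>y\<^sub>j ^ (p - 1)\<close> is a polynomial in \<open>y\<^sub>j ^ k\<close>, hence in \<open>z\<close>, and
  \<open>y\<^sub>j = y\<^sub>j ^ p / y\<^sub>j ^ (p - 1)\<close>.\<close>

lemma frob_span_z: "f \<in> frob_f.frob_span z"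
proof (rule function_field_generated)
  show const: "ff_const \<phi> c \<in> frob_f.frob_span z" for c
    by (subst const_frob) (rule frob_f.frob_span_frob)
  fix j assume j: "j \<in> {1..n+1}"
  consider "j = 1" | "j = 2" | "j \<in> {3..n+1}" using j by fastforce
  then show "y j \<in> frob_f.frob_span z"
  proof cases
    case 1
    then show ?thesis using const[of 1] ycoord_1 by (simp add: ff_const_1)
  next
    case 2
    then show ?thesis using frob_f.frob_span_z_power[of z 1] by simp
  next
    case 3
    obtain e where e: "p - 1 = k * e" using k(2) by blast
    \<comment> \<open>The sign is written as a \<open>p\<close>-th power so that the closure rule for scalars applies.\<close>
    have "y j ^ k = (- 1) ^ p * z ^ k + ff_const \<phi> (- lam (j - 3))"
      using y_power_k[OF 3] by (simp add: frob_f.frob_minus ff_const_minus)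
    then have "y j ^ k \<in> frob_f.frob_span z"
      by (simp only:) (intro frob_f.frob_span_add frob_f.frob_span_frob_mult frob_f.frob_span_z_power const)
    then have "inverse (y j ^ (p - 1)) \<in> frob_f.frob_span z"
      unfolding e power_mult by (rule frob_f.frob_span_inverse[OF frob_f.frob_span_power])
    then have "y j ^ p * inverse (y j ^ (p - 1)) \<in> frob_f.frob_span z"
      by (rule frob_f.frob_span_frob_mult)
    moreover have "y j ^ p = y j * y j ^ (p - 1)" using frob_f.p_pos by (simp add: power_eq_if)
    then have "y j ^ p * inverse (y j ^ (p - 1)) = y j" using y_nonzero[OF j] by simp
    ultimately show ?thesis by (simp only:)
  qed
qed (auto intro: frob_f.frob_span_add frob_f.frob_span_mult frob_f.frob_span_inverse)

text \<open>If \<open>z\<close> were a \<open>p\<close>-th power then so would be every element of \<open>F = F\<^sup>p[z]\<close>, including \<open>t\<close>.\<close>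

lemma z_not_frob: "z \<notin> range (\<lambda>f. f ^ p)"
proof
  assume "z \<in> range (\<lambda>f. f ^ p)"
  then obtain w where w: "z = w ^ p" by blast
  obtain u where "t = (\<Sum>i<p. u i ^ p * z ^ i)" using frob_span_z[of t] unfolding frob_f.frob_span_def by blast
  then have "t = (\<Sum>i<p. u i * w ^ i) ^ p"
    by (simp add: w frob_f.frob_sum power_mult_distrib mult.commute flip: power_mult)
  then show False using t by blast
qed

sublocale p_basis_field p z \<phi>
proof unfold_locales
  show "\<exists>u. f = (\<Sum>i<p. u i ^ p * z ^ i)" for f
    using frob_span_z[of f] unfolding frob_f.frob_span_def by blast
  show "ff_const \<phi> c \<in> range (\<lambda>f. f ^ p)" for c using const_frob by blast
qed (rule z_not_frob)

lemma of_nat_k: "(of_nat k :: 'f) \<noteq> 0"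
proof -
  have "k \<le> p - 1" using k char by (intro dvd_imp_le) auto
  then show ?thesis using k char by (intro frob_f.of_nat_nonzero) auto
qed

lemma deriv_y:
  assumes j: "j \<in> {3..n+1}"
  shows "deriv (y j) = - (z ^ (k - 1) / y j ^ (k - 1))"
proof -
  have "deriv (y j ^ k) = deriv (- (z ^ k)) + deriv (ff_const \<phi> (- lam (j - 3)))"
    unfolding y_power_k[OF j] deriv_add[symmetric] by (simp add: ff_const_minus)
  moreover have "deriv (ff_const \<phi> (- lam (j - 3))) = 0"
    by (subst const_frob) (rule deriv_frob)
  ultimately have "of_nat k * (y j ^ (k - 1) * deriv (y j)) = of_nat k * (- (z ^ (k - 1)))"
    by (simp add: deriv_minus deriv_power deriv_z mult.assoc)
  then have "y j ^ (k - 1) * deriv (y j) = - (z ^ (k - 1))"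
    by (rule mult_left_cancel[OF of_nat_k, THEN iffD1])
  then show ?thesis using y_nonzero[of j] j by (simp add: field_simps)
qed

lemma deriv_inverse_z: "deriv (1 / z) = - ((1 / z) ^ 2)"
proof -
  have "z * deriv (1 / z) + 1 / z * deriv z = 0"
    using deriv_mult[of z "1 / z"] z_nonzero by (simp add: deriv_1)
  then show ?thesis using z_nonzero by (simp add: deriv_z field_simps power2_eq_square eq_neg_iff_add_eq_0)
qed

text \<open>A single term \<open>a dg\<close> suffices as a regular representative at each point of the curve.\<close>

lemma regular_atI:
  assumes "a \<in> local_ring n X \<phi> P" "g \<in> local_ring n X \<phi> P" "z_coeff \<eta> = a * deriv g"
  shows "regular_at n X \<phi> P (one_form \<phi> \<eta>)"
  unfolding regular_at_def
proof (intro bexI[of _ "fscale a (fd g)"] ballI)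
  show "fscale a (fd g) \<in> one_form \<phi> \<eta>"
    using assms(3) by (simp add: mem_one_form_iff z_coeff_fscale z_coeff_fd)
  fix h assume "h \<in> Poly_Mapping.keys (fscale a (fd g))"
  then have "h = g" by (auto simp: in_keys_iff lookup_fscale fd_def lookup_single when_def split: if_splits)
  then show "h \<in> local_ring n X \<phi> P \<and> Poly_Mapping.lookup (fscale a (fd g)) h \<in> local_ring n X \<phi> P"
    using assms by (simp add: lookup_fscale fd_def)
qed

lemma z_coeff_theta: "z_coeff (theta_rep n \<phi> r \<alpha>) = z powi r / (\<Prod>j=3..n+1. y j ^ \<alpha> j)"
  by (simp add: theta_rep_def z_coeff_fscale z_coeff_fd deriv_z)

text \<open>The points where some \<open>x\<^sub>i\<close> vanishes: at infinity (\<open>x\<^sub>1 = 0\<close>) all other \<open>x\<^sub>j ^ k\<close> agree up to sign, and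
  elsewhere the branch points \<open>x\<^sub>2 ^ k = - \<lambda>\<^sub>i\<^sub>-\<^sub>3 * x\<^sub>1 ^ k\<close> are distinct and nonzero because the \<open>\<lambda>\<^sub>i\<close> are.\<close>

lemma vanishing_coordinates:
  assumes P: "P \<in> X"
  shows "vanishes_at (pvar 1) P \<Longrightarrow> j \<in> {2..n+1} \<Longrightarrow> \<not> vanishes_at (pvar j) P"
    and "\<not> vanishes_at (pvar 1) P \<Longrightarrow> i \<in> {3..n+1} \<Longrightarrow> vanishes_at (pvar i) P \<Longrightarrow>
      j \<in> {2..n+1} \<Longrightarrow> j \<noteq> i \<Longrightarrow> \<not> vanishes_at (pvar j) P"
proof -
  have proj: "P \<in> proj_space n" using P curve_iff by blast
  obtain x where x: "x \<in> P" "\<exists>i\<in>{1..n+1}. x i \<noteq> 0" using proj_space_rep[OF proj] by blast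
  have van: "vanishes_at (pvar i) P \<longleftrightarrow> x i = 0" if "i \<in> {1..n+1}" for i
    using vanishes_at_iff[OF proj x(1) forms_pvar[OF that]] by (simp add: peval_pvar)
  have eq: "x j ^ k = - (lam (j - 3) * x 1 ^ k) - x 2 ^ k" if "j \<in> {3..n+1}" for j
  proof -
    have "peval (equation j) x = 0" using P that x(1) curve_iff by (auto simp: vanishes_at_def)
    then show ?thesis by (simp add: peval_equation eq_neg_iff_add_eq_0 algebra_simps)
  qed
  have k0: "k > 0" using k by simp
  show "\<not> vanishes_at (pvar j) P" if 1: "vanishes_at (pvar 1) P" and j: "j \<in> {2..n+1}"
  proof
    assume "vanishes_at (pvar j) P"
    then have x1: "x 1 = 0" and xj: "x j = 0" using van[of j] van[of 1] 1 j by auto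
    then have e: "x i ^ k = - (x 2 ^ k)" if "i \<in> {3..n+1}" for i using eq[OF that] k0 by simp
    have x2: "x 2 = 0"
      using e[of j] xj j k0 by (cases "j = 2") (auto simp: power_0_left)
    have "x i = 0" if i: "i \<in> {1..n+1}" for i
    proof -
      consider "i = 1" | "i = 2" | "i \<in> {3..n+1}" using i by fastforce
      then show ?thesis using x1 x2 e[of i] k0 by cases (auto simp: power_0_left)
    qed
    then show False using x(2) by blast
  qed
  show "\<not> vanishes_at (pvar j) P" if 1: "\<not> vanishes_at (pvar 1) P" and i: "i \<in> {3..n+1}"
    and vi: "vanishes_at (pvar i) P" and j: "j \<in> {2..n+1}" "j \<noteq> i"
  proof
    assume "vanishes_at (pvar j) P"
    then have x1: "x 1 \<noteq> 0" and xj: "x j = 0" and xi: "x i = 0" using van[of j] van[of 1] van[of i] 1 i vi j by auto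
    have x2: "x 2 ^ k = - (lam (i - 3) * x 1 ^ k)" using eq[OF i] xi k0 by (simp add: power_0_left algebra_simps)
    show False
    proof (cases "j = 2")
      case True
      then have "lam (i - 3) = 0" using x2 xj k0 x1 by (simp add: power_0_left)
      moreover have "i - 3 \<le> n - 2" using i n by auto
      ultimately show False using lam_nonzero by blast
    next
      case False
      then have "lam (i - 3) * x 1 ^ k = lam (j - 3) * x 1 ^ k"
        using eq[of j] xj k0 j x2 by (simp add: power_0_left)
      then have "lam (i - 3) = lam (j - 3)" using x1 by simp
      moreover have "j - 3 \<le> n - 2" "i - 3 \<le> n - 2" using i j n by auto
      ultimately have "i - 3 = j - 3" using lam_inj by blast
      then show False using i j False by auto
    qed
  qed
qed

text \<open>The local parameters are \<open>1 / z\<close> at infinity, \<open>y\<^sub>i\<close> at a zero of \<open>y\<^sub>i\<close>, and \<open>z\<close> serves elsewhere.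
  At infinity the form has the factor \<open>(1 / z) ^ (\<Sum> \<alpha>\<^sub>j - r - 2)\<close>, at a zero of \<open>y\<^sub>i\<close> the
  factor \<open>y\<^sub>i ^ (k - 1 - \<alpha>\<^sub>i)\<close>; membership in the index set makes both exponents nonnegative.\<close>

lemma theta_holomorphic:
  assumes index: "(r, \<alpha>) \<in> index_set k n"
  shows "one_form \<phi> (theta_rep n \<phi> r \<alpha>) \<in> H10 n X \<phi>"
proof -
  define J where "J = {3..n+1}"
  define A where "A = (\<Sum>j\<in>J. \<alpha> j)"
  define s where "s = nat r"
  have r: "r = int s" and sA: "s + 2 \<le> A" and \<alpha>k: "\<And>j. j \<in> J \<Longrightarrow> \<alpha> j \<le> k - 1"
  proof -
    have "(\<forall>j\<in>J. \<alpha> j \<in> {0..k-1}) \<and> 0 \<le> r \<and> r \<le> int A - 2"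
      using index by (auto simp only: index_set_def mem_Collect_eq case_prod_conv A_def J_def)
    then show "r = int s" "s + 2 \<le> A" "\<And>j. j \<in> J \<Longrightarrow> \<alpha> j \<le> k - 1"
      by (auto simp: s_def)
  qed
  have J: "finite J" "\<And>j. j \<in> J \<Longrightarrow> j \<in> {1..n+1}" "\<And>j. j \<in> J \<Longrightarrow> j \<in> {2..n+1}"
    by (auto simp: J_def)
  have coeff: "z_coeff (theta_rep n \<phi> r \<alpha>) = z ^ s * (\<Prod>j\<in>J. (1 / y j) ^ \<alpha> j)"
    using z_coeff_theta[of r \<alpha>] unfolding J_def[symmetric]
    by (simp add: r power_divide prod_dividef)
  have "regular_at n X \<phi> P (one_form \<phi> (theta_rep n \<phi> r \<alpha>))" if P: "P \<in> X" for P
  proof (cases "vanishes_at (pvar 1) P")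
    case True
    note nv = vanishing_coordinates(1)[OF P True]
    have inv: "1 / z \<in> local_ring n X \<phi> P"
      using local_ring_coord[OF P, of 1 2] nv[of 2] n ycoord_1 by simp
    have w: "z / y j \<in> local_ring n X \<phi> P" if "j \<in> J" for j
      using local_ring_coord[OF P, of 2 j] nv[of j] J(2,3)[OF that] n by simp
    show ?thesis
    proof (rule regular_atI[OF _ inv])
      let ?a = "- ((1 / z) ^ (A - s - 2) * (\<Prod>j\<in>J. (z / y j) ^ \<alpha> j))"
      show "?a \<in> local_ring n X \<phi> P"
        by (intro local_ring_minus local_ring_mult local_ring_power local_ring_prod P inv w)
      have "(\<Prod>j\<in>J. (z / y j) ^ \<alpha> j) = z ^ A * (\<Prod>j\<in>J. (1 / y j) ^ \<alpha> j)"
        by (simp add: A_def power_sum power_divide flip: prod.distrib)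
      moreover have "z ^ A = z ^ s * z ^ (A - s - 2) * z ^ 2"
      proof -
        have "A = s + (A - s - 2) + 2" using sA by simp
        then show ?thesis by (metis power_add)
      qed
      ultimately show "z_coeff (theta_rep n \<phi> r \<alpha>) = ?a * deriv (1 / z)"
        unfolding coeff deriv_inverse_z using z_nonzero by (simp add: power_divide)
    qed
  next
    case False
    have y: "y j \<in> local_ring n X \<phi> P" if "j \<in> {1..n+1}" for j
      using local_ring_coord[OF P that _ False] ycoord_1 by simp
    have z: "z \<in> local_ring n X \<phi> P" using y[of 2] n by simp
    have inv: "1 / y j \<in> local_ring n X \<phi> P" if "\<not> vanishes_at (pvar j) P" "j \<in> {1..n+1}" for j
      using local_ring_coord[OF P _ that(2) that(1), of 1] ycoord_1 by simp
    show ?thesis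
    proof (cases "\<exists>i\<in>J. vanishes_at (pvar i) P")
      case no_zero: False
      show ?thesis
      proof (rule regular_atI[OF _ z])
        show "z ^ s * (\<Prod>j\<in>J. (1 / y j) ^ \<alpha> j) \<in> local_ring n X \<phi> P"
          using no_zero J(2) by (intro local_ring_mult local_ring_power local_ring_prod P z inv) auto
      qed (simp add: coeff deriv_z)
    next
      case True
      then obtain i where i: "i \<in> J" "vanishes_at (pvar i) P" by blast
      have nv: "\<not> vanishes_at (pvar j) P" if "j \<in> {2..n+1}" "j \<noteq> i" for j
        using vanishing_coordinates(2)[OF P False _ i(2) that] i(1) by (simp add: J_def)
      have yi: "y i \<noteq> 0" using y_nonzero J(2) i(1) by blast
      have "2 \<noteq> i" using i(1) by (auto simp: J_def)
      then have invz: "1 / z \<in> local_ring n X \<phi> P" using inv[of 2] nv[of 2] n by simp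
      show ?thesis
      proof (rule regular_atI)
        let ?a = "- (z ^ s * (1 / z) ^ (k - 1) * y i ^ (k - 1 - \<alpha> i) * (\<Prod>j\<in>J - {i}. (1 / y j) ^ \<alpha> j))"
        show "?a \<in> local_ring n X \<phi> P"
          using nv J(2,3) i(1)
          by (intro local_ring_minus local_ring_mult local_ring_power local_ring_prod P z invz y inv) auto
        show "y i \<in> local_ring n X \<phi> P" using y J(2) i(1) by blast
        have "(1 / y i) ^ \<alpha> i = y i ^ (k - 1 - \<alpha> i) / y i ^ (k - 1)"
        proof -
          have "y i ^ (k - 1) = y i ^ (k - 1 - \<alpha> i) * y i ^ \<alpha> i"
            using \<alpha>k[OF i(1)] by (metis le_add_diff_inverse2 power_add)
          then show ?thesis using yi by (simp add: power_divide)
        qed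
        then have "(\<Prod>j\<in>J. (1 / y j) ^ \<alpha> j) =
            y i ^ (k - 1 - \<alpha> i) / y i ^ (k - 1) * (\<Prod>j\<in>J - {i}. (1 / y j) ^ \<alpha> j)"
          using prod.remove[OF J(1) i(1), of "\<lambda>j. (1 / y j) ^ \<alpha> j"] by simp
        moreover have "deriv (y i) = - (z ^ (k - 1) / y i ^ (k - 1))"
          using deriv_y i(1) by (simp add: J_def)
        ultimately show "z_coeff (theta_rep n \<phi> r \<alpha>) = ?a * deriv (y i)"
          unfolding coeff using z_nonzero by (simp add: power_divide)
      qed
    qed
  qed
  then show ?thesis by (simp add: H10_def)
qed

abbreviation eval_z :: "'a poly \<Rightarrow> 'f" where
  "eval_z q \<equiv> poly (map_poly (ff_const \<phi>) q) z"

lemma ff_const_sum: "ff_const \<phi> (\<Sum>i\<in>A. f i) = (\<Sum>i\<in>A. ff_const \<phi> (f i))"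
  by (induction A rule: infinite_finite_induct) (auto simp: ff_const_0 ff_const_add)

lemma eval_z_add: "eval_z (q + s) = eval_z q + eval_z s"
proof -
  have "map_poly (ff_const \<phi>) (q + s) = map_poly (ff_const \<phi>) q + map_poly (ff_const \<phi>) s"
    by (rule poly_eqI) (simp add: coeff_map_poly ff_const_0 ff_const_add)
  then show ?thesis by simp
qed

lemma eval_z_mult: "eval_z (q * s) = eval_z q * eval_z s"
proof -
  have "map_poly (ff_const \<phi>) (q * s) = map_poly (ff_const \<phi>) q * map_poly (ff_const \<phi>) s"
    by (rule poly_eqI) (simp add: coeff_map_poly ff_const_0 coeff_mult ff_const_sum ff_const_mult)
  then show ?thesis by simp
qed

lemma eval_z_monom: "eval_z (monom a m) = ff_const \<phi> a * z ^ m"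
  by (simp add: map_poly_monom ff_const_0 poly_monom)

lemma eval_z_1: "eval_z 1 = 1"
  using eval_z_monom[of 1 0] by (simp add: ff_const_1)

lemma eval_z_diff: "eval_z (q - s) = eval_z q - eval_z s"
  using eval_z_add[of "q - s" s] by simp

lemma eval_z_power: "eval_z (q ^ m) = eval_z q ^ m"
  by (induction m) (auto simp: eval_z_1 eval_z_mult)

lemma eval_z_prod: "eval_z (\<Prod>i\<in>A. f i) = (\<Prod>i\<in>A. eval_z (f i))"
  by (induction A rule: infinite_finite_induct) (auto simp: eval_z_1 eval_z_mult)

lemma eval_z_sum: "eval_z (\<Sum>i\<in>A. f i) = (\<Sum>i\<in>A. eval_z (f i))"
  by (induction A rule: infinite_finite_induct) (auto simp: eval_z_add)

lemma eval_z_equation: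
  assumes "j \<in> {3..n+1}"
  shows "eval_z (- monom 1 k - [:lam (j - 3):]) = y j ^ k"
proof -
  have "eval_z (- monom 1 k) = - (z ^ k)"
    using eval_z_diff[of 0 "monom 1 k"] by (simp add: eval_z_monom ff_const_1)
  moreover have "eval_z [:lam (j - 3):] = ff_const \<phi> (lam (j - 3))"
    using eval_z_monom[of "lam (j - 3)" 0] by (simp add: monom_0)
  ultimately show ?thesis using eval_z_diff y_power_k[OF assms] by simp
qed

text \<open>The polynomial of the statement, evaluated at \<open>z\<close>, is the \<open>(p - 1)\<close>-st power of the denominator of \<open>\<theta>\<close>,
  by \<open>y\<^sub>j ^ k = - z ^ k - \<lambda>\<^sub>j\<^sub>-\<^sub>3\<close>.\<close>

lemma denominator_expansion:
  assumes "(\<Prod>j=3..n+1. (- monom 1 k - [:lam (j - 3):]) ^ (\<alpha> j * ((p - 1) div k))) =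
            (\<Sum>s=0..N. monom (c (int s)) s)"
  shows "(\<Prod>j=3..n+1. y j ^ \<alpha> j) ^ (p - 1) = (\<Sum>s=0..N. ff_const \<phi> (c (int s)) * z ^ s)"
proof -
  have "(\<Prod>j=3..n+1. y j ^ \<alpha> j) ^ (p - 1) = (\<Prod>j=3..n+1. (y j ^ k) ^ (\<alpha> j * ((p - 1) div k)))"
    unfolding prod_power_distrib
  proof (intro prod.cong refl)
    fix j
    have "\<alpha> j * (p - 1) = k * (\<alpha> j * ((p - 1) div k))" using k(2) by simp
    then show "(y j ^ \<alpha> j) ^ (p - 1) = (y j ^ k) ^ (\<alpha> j * ((p - 1) div k))"
      by (metis power_mult)
  qed
  also have "\<dots> = eval_z (\<Prod>j=3..n+1. (- monom 1 k - [:lam (j - 3):]) ^ (\<alpha> j * ((p - 1) div k)))"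
    unfolding eval_z_prod eval_z_power by (intro prod.cong refl) (simp only: eval_z_equation)
  also have "\<dots> = (\<Sum>s=0..N. ff_const \<phi> (c (int s)) * z ^ s)"
    unfolding assms eval_z_sum by (simp add: eval_z_monom)
  finally show ?thesis .
qed

text \<open>The computation of the theorem on \<open>dz\<close>-coefficients. In the sum over the exponents \<open>i\<close> of
  \<open>Y ^ (p - 1)\<close> only those with \<open>i + r + 1 = l * p\<close> survive \<open>cart\<close>; the bounds \<open>i \<le> (p - 1) * A\<close> and
  \<open>r \<le> A - 2\<close> give \<open>l * p < A * p\<close>. Conversely, an \<open>l\<close> in the range whose index \<open>l * p - r - 1\<close> is not an
  exponent contributes \<open>0\<close>, as \<open>c\<close> vanishes there.\<close>

lemma cart_theta:
  fixes r :: int and \<alpha> :: "nat \<Rightarrow> nat" and c :: "int \<Rightarrow> 'a"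
  defines "A \<equiv> \<Sum>j=3..n+1. \<alpha> j"
  assumes index: "(r, \<alpha>) \<in> index_set k n"
    and c: "(\<Prod>j=3..n+1. (- monom 1 k - [:lam (j - 3):]) ^ (\<alpha> j * ((p - 1) div k))) =
            (\<Sum>s=0..(p - 1) * A. monom (c (int s)) s)"
    and c0: "\<forall>s. s \<notin> {0..int ((p - 1) * A)} \<longrightarrow> c s = 0"
  shows "z_coeff (\<Sum>l=1..A - 1.
           fscale (ff_const \<phi> (proot p (c (int l * int p - r - 1)))) (theta_rep n \<phi> (int l - 1) \<alpha>))
         = cart (z_coeff (theta_rep n \<phi> r \<alpha>))"
proof -
  define Y where "Y = (\<Prod>j=3..n+1. y j ^ \<alpha> j)"
  define N where "N = (p - 1) * A"
  define s where "s = nat r"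
  define C where "C i = ff_const \<phi> (proot p (c i))" for i
  have r: "r = int s" and sA: "s + 2 \<le> A"
  proof -
    have "0 \<le> r \<and> r \<le> int A - 2"
      using index by (auto simp only: index_set_def mem_Collect_eq case_prod_conv A_def)
    then show "r = int s" "s + 2 \<le> A" by (auto simp: s_def)
  qed
  have C_frob: "ff_const \<phi> (c i) = C i ^ p" for i
    unfolding C_def by (rule const_frob)
  have C0: "C i = 0" if "i \<notin> {0..int N}" for i
  proof -
    have "C i ^ p = 0" using C_frob[of i] c0 that by (simp add: N_def ff_const_0)
    then show ?thesis by simp
  qed
  have Y0: "Y \<noteq> 0" using y_nonzero by (auto simp: Y_def)
  have Yp: "Y ^ (p - 1) = (\<Sum>i=0..N. C (int i) ^ p * z ^ i)"
    using denominator_expansion[OF c] by (simp add: Y_def N_def C_frob)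
  have "Y ^ p = Y * Y ^ (p - 1)" using frob_f.p_pos by (simp add: power_eq_if)
  then have "z ^ s / Y = (1 / Y) ^ p * (z ^ s * Y ^ (p - 1))"
    using Y0 by (simp add: field_simps)
  also have "z ^ s * Y ^ (p - 1) = (\<Sum>i=0..N. C (int i) ^ p * z ^ (i + s))"
    unfolding Yp sum_distrib_left by (intro sum.cong refl) (simp add: power_add mult_ac)
  finally have "cart (z ^ s / Y) = 1 / Y * (\<Sum>i=0..N. C (int i) * cart (z ^ (i + s)))"
    by (simp only: cart_frob_mult cart_sum)
  also have "(\<Sum>i=0..N. C (int i) * cart (z ^ (i + s))) =
      (\<Sum>l=1..A-1. C (int l * int p - r - 1) * z ^ (l - 1))"
  proof -
    define S where "S = {i \<in> {0..N}. p dvd Suc (i + s)}"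
    define T where "T = {l \<in> {1..A-1}. int l * int p - r - 1 \<in> {0..int N}}"
    have "(\<Sum>i=0..N. C (int i) * cart (z ^ (i + s))) = (\<Sum>i\<in>S. C (int i) * cart (z ^ (i + s)))"
      by (rule sum.mono_neutral_right) (auto simp: S_def cart_z_power)
    also have "\<dots> = (\<Sum>l\<in>T. C (int l * int p - r - 1) * z ^ (l - 1))"
    proof (rule sum.reindex_bij_witness[where i = "\<lambda>l. l * p - s - 1" and j = "\<lambda>i. Suc (i + s) div p"])
      fix i assume i: "i \<in> S"
      then have dvd: "p dvd Suc (i + s)" and iN: "i \<le> N" by (auto simp: S_def)
      define l where "l = Suc (i + s) div p"
      have l: "l * p = Suc (i + s)" using dvd by (simp add: l_def)
      then have l0: "l \<noteq> 0" by (intro notI) simp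
      have "p * A = Suc (p - 1) * A" using frob_f.p_pos by simp
      then have "N + A = p * A" by (simp only: N_def mult_Suc add.commute)
      then have "l * p < A * p" using l iN sA by (simp add: mult.commute)
      then have lA: "l < A" by simp
      have val: "int l * int p - r - 1 = int i" using arg_cong[OF l, of int] r by simp
      show "(Suc (i + s) div p) * p - s - 1 = i" using l by (simp add: l_def)
      show "Suc (i + s) div p \<in> T"
        unfolding l_def[symmetric] T_def using l0 lA val iN by auto
      show "C (int (Suc (i + s) div p) * int p - r - 1) * z ^ (Suc (i + s) div p - 1)
          = C (int i) * cart (z ^ (i + s))"
        unfolding cart_z_power using dvd val by (simp only: l_def if_True)
    next
      fix l assume "l \<in> T"
      then have "0 \<le> int l * int p - r - 1" "int l * int p - r - 1 \<le> int N" by (auto simp: T_def)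
      then have "int s + 1 \<le> int (l * p)" "int (l * p) \<le> int N + int s + 1"
        unfolding r by simp_all
      then have ge: "s + 1 \<le> l * p" and le: "l * p \<le> N + s + 1" by linarith+
      then have eq: "Suc ((l * p - s - 1) + s) = l * p" by simp
      show "Suc ((l * p - s - 1) + s) div p = l" unfolding eq using frob_f.p_pos by simp
      show "l * p - s - 1 \<in> S"
        unfolding S_def mem_Collect_eq eq using le by auto
    qed
    also have "\<dots> = (\<Sum>l=1..A-1. C (int l * int p - r - 1) * z ^ (l - 1))"
      using C0 by (intro sum.mono_neutral_left) (auto simp: T_def)
    finally show ?thesis .
  qed
  also have "1 / Y * (\<Sum>l=1..A-1. C (int l * int p - r - 1) * z ^ (l - 1)) =
      (\<Sum>l=1..A-1. C (int l * int p - r - 1) * (z powi (int l - 1) / Y))"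
    unfolding sum_distrib_left
  proof (intro sum.cong refl)
    fix l assume "l \<in> {1..A-1}"
    then have l: "int l - 1 = int (l - 1)" by auto
    have "z powi (int l - 1) = z ^ (l - 1)" unfolding l by (rule power_int_of_nat)
    then show "1 / Y * (C (int l * int p - r - 1) * z ^ (l - 1)) =
        C (int l * int p - r - 1) * (z powi (int l - 1) / Y)" by simp
  qed
  finally show ?thesis
    unfolding z_coeff_sum z_coeff_fscale z_coeff_theta Y_def[symmetric] C_def r
    by (simp only: power_int_of_nat)
qed

end

theorem theorem5p3:
  fixes p n k :: nat
    and lam :: "nat \<Rightarrow> 'a::alg_closed_field"
    and \<phi> :: "'a mpoly \<Rightarrow> 'a mpoly \<Rightarrow> 'f::field"
    and t :: 'f
    and r :: int and \<alpha> :: "nat \<Rightarrow> nat" and c :: "int \<Rightarrow> 'a"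
  assumes char: "CHAR('a) = p" "p \<ge> 3"
    and n: "n \<ge> 2" and k: "k \<ge> 2" "k dvd p - 1" and genus: "(k - 1) * (n - 1) \<ge> 2"
    and lams: "\<forall>i\<in>{1..n-2}. lam i \<notin> {0, 1}" "inj_on lam {1..n-2}"
    and lam_0: "lam 0 = 1"
    and ff: "function_field n (gf_curve k n lam) \<phi>"
    and t: "t \<notin> range (\<lambda>f::'f. f ^ p)"
    and index: "(r, \<alpha>) \<in> index_set k n"
    and c: "(\<Prod>j=3..n+1. (- monom 1 k - [:lam (j - 3):]) ^ (\<alpha> j * ((p - 1) div k))) =
            (\<Sum>s=0..(p - 1) * (\<Sum>j=3..n+1. \<alpha> j). monom (c (int s)) s)"
    and c0: "\<forall>s. s \<notin> {0..int ((p - 1) * (\<Sum>j=3..n+1. \<alpha> j))} \<longrightarrow> c s = 0"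
  shows "cartier n (gf_curve k n lam) \<phi> t (one_form \<phi> (theta_rep n \<phi> r \<alpha>)) =
         one_form \<phi> (\<Sum>l=1..(\<Sum>j=3..n+1. \<alpha> j) - 1.
           fscale (ff_const \<phi> (proot p (c (int l * int p - r - 1)))) (theta_rep n \<phi> (int l - 1) \<alpha>))"
proof -
  interpret generalized_fermat p n k lam \<phi> t
    by unfold_locales (fact char n k lams lam_0 ff t)+
  show ?thesis
    by (rule cartier_one_form[OF t theta_holomorphic[OF index] cart_theta[OF index c c0]])
qed

end
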